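(* Let $\mathbf{p},\mathbf{q}\in\mathcal{Q}(I)$ be projections represented, for one and the same partition of $X$, by local liftings $(p_0,\dots,p_n)$ and $(q_0,\dots,q_n)$ respectively, such that for each $i$ the projections $p_i(x)$ and $q_i(x)$ are full and properly infinite in $\mathcal{M}(B)$ for all $x\in X_i$. Assume $\mathbf{p}\sim\mathbf{q}$ (Murray-von Neumann equivalence in $\mathcal{Q}(I)$). Let $T_i\in\mathcal{M}(I_i)$, $i=0,\dots,n$, be the partial isometries associated with this equivalence as described in the context, and let $$t_i=[p_i-T_i^*T_i]_0-[q_i-T_iT_i^*]_0\in K_0(B).$$ Then, for each $i$, $$t_i=[p_i:T_i^*T_i]-[q_i:T_iT_i^*],$$ where the essential codimensions on the right are those of the evaluations at a point of $X_i$.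
   Context: Standing setting: $B$ is a simple, stable $C^*$-algebra such that the multiplier algebra $\mathcal{M}(B)$ has real rank zero. $X$ is $[0,1]$, $[0,\infty)$, $(-\infty,\infty)$ or the circle $[0,1]/\{0,1\}$. $I=C(X)\otimes B$ if $X$ is compact and $I=C_0(X)\otimes B$ otherwise. $\mathcal{M}(I)=C_b(X,\mathcal{M}(B)_s)$ is the algebra of bounded strictly continuous functions $X\to\mathcal{M}(B)$, $\mathcal{Q}(I)=\mathcal{M}(I)/I$ is the corona algebra, and $\pi$ is the quotient map. Local liftings: partition points $x_1<\dots<x_n$ in the interior of $X$ divide $X$ (for the circle, $[0,1]$) into closed subintervals $X_0,\dots,X_n$, with $x_i$ the common point of $X_{i-1}$ and $X_i$. For the circle put $x_0=0=1$. Let $f_i\in C_b(X_i,\mathcal{M}(B)_s)$ with $f_i(x_i)-f_{i-1}(x_i)\in B$ for $i=1,\dots,n$ (and $f_0(x_0)-f_n(x_0)\in B$ for the circle). The tuple $(f_0,\dots,f_n)$ represents the element of $\mathcal{Q}(I)$ whose coset consists of all $f\in\mathcal{M}(I)$ such that, for every $i$, $f|_{X_i}-f_i$ is a norm continuous $B$-valued function on $X_i$ which vanishes in norm at any infinite end point of $X_i$. A local lifting of a projection $\mathbf{p}$ is such a representing tuple $(p_0,\dots,p_n)$ in which each $p_i$ is projection valued. For each $i$, $I_i=C(X_i)\otimes B$ if $X_i$ is compact and $I_i=C_0(X_i)\otimes B$ otherwise. $\pi$ also denotes the quotient map $\mathcal{M}(I_i)\to\mathcal{Q}(I_i)=\mathcal{M}(I_i)/I_i$.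 Construction of $T_i$: choose $u\in\mathcal{M}(I)$ with $\pi(u)^*\pi(u)=\mathbf{p}$ and $\pi(u)\pi(u)^*=\mathbf{q}$, and put $u_i=q_i\,u|_{X_i}\,p_i$. Choose $v_i,w_i\in\mathcal{M}(I_i)$ with $v_i^*v_i=1$, $v_iv_i^*=p_i$, $w_iw_i^*=1$, $w_i^*w_i=q_i$. Then $\pi(w_iu_iv_i)$ is a unitary in $\mathcal{Q}(I_i)$. Let $\widetilde{u_i}\in\mathcal{M}(I_i)$ be a partial isometry with $\pi(\widetilde{u_i})=\pi(w_iu_iv_i)$, so $\pi(\widetilde{u_i}^*\widetilde{u_i})=\pi(\widetilde{u_i}\widetilde{u_i}^* )=1$. Put $T_i=w_i^*\widetilde{u_i}v_i^*$. Then $T_i$ is a partial isometry with $T_i^*T_i\le p_i$, $T_iT_i^*\le q_i$, and $p_i-T_i^*T_i$, $q_i-T_iT_i^*\in I_i$. For a norm continuous projection-valued function $r:X_i\to B$, $[r]_0\in K_0(B)$ is the class of $r(x)$ for any $x\in X_i$. Essential codimension: for projections $p,q\in\mathcal{M}(B)$ with $p-q\in B$, let $\phi,\psi:\mathbb{C}\to\mathcal{M}(B)$ be the $*$-homomorphisms with $\phi(1)=p$, $\psi(1)=q$. Then $(\phi,\psi)$ is a Cuntz pair and $[p:q]\in K_0(B)$ is its class under $KK(\mathbb{C},B)\cong K_0(B)$. The normalization is $[p:q]=[p]_0-[q]_0$ when $p,q\in B$. *)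

theory Defs
  imports "HOL-Analysis.Analysis" "HOL-Algebra.QuotRing"
begin

section \<open>Unital C*-algebras\<close>

class cstar_algebra_1 = real_normed_algebra_1 + banach +
  fixes scaleC :: "complex \<Rightarrow> 'a \<Rightarrow> 'a"  (infixr \<open>*\<^sub>C\<close> 75)
    and star :: "'a \<Rightarrow> 'a"
  assumes scaleC_of_real: "scaleC (of_real r) a = r *\<^sub>R a"
    and scaleC_scaleC: "scaleC y (scaleC z a) = scaleC (y * z) a"
    and scaleC_add_left: "scaleC (y + z) a = scaleC y a + scaleC z a"
    and scaleC_add_right: "scaleC z (a + b) = scaleC z a + scaleC z b"
    and scaleC_mult_left: "scaleC z a * b = scaleC z (a * b)"
    and scaleC_mult_right: "a * scaleC z b = scaleC z (a * b)"
    and norm_scaleC: "norm (scaleC z a) = cmod z * norm a"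
    and star_star: "star (star a) = a"
    and star_add: "star (a + b) = star a + star b"
    and star_scaleC: "star (scaleC z a) = scaleC (cnj z) (star a)"
    and star_mult: "star (a * b) = star b * star a"
    and cstar_identity: "norm (star a * a) = norm a ^ 2"

instantiation complex :: cstar_algebra_1
begin

definition scaleC_complex :: "complex \<Rightarrow> complex \<Rightarrow> complex" where
  "scaleC_complex z a = z * a"

definition star_complex :: "complex \<Rightarrow> complex" where
  "star_complex a = cnj a"

instance
  by standard
    (auto simp: scaleC_complex_def star_complex_def algebra_simps norm_mult power2_eq_square
      scaleR_conv_of_real)

end

definition star_hom :: "('a::cstar_algebra_1 \<Rightarrow> 'b::cstar_algebra_1) \<Rightarrow> bool" where
  "star_hom \<phi> \<longleftrightarrow>
     (\<forall>a b. \<phi> (a + b) = \<phi> a + \<phi> b) \<and> (\<forall>z a. \<phi> (z *\<^sub>C a) = z *\<^sub>C \<phi> a) \<and>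
     (\<forall>a b. \<phi> (a * b) = \<phi> a * \<phi> b) \<and> (\<forall>a. \<phi> (star a) = star (\<phi> a))"

definition projection :: "'a::cstar_algebra_1 \<Rightarrow> bool" where
  "projection p \<longleftrightarrow> p * p = p \<and> star p = p"

definition partial_isometry :: "'a::cstar_algebra_1 \<Rightarrow> bool" where
  "partial_isometry v \<longleftrightarrow> projection (star v * v)"

definition mvn_equiv :: "'a::cstar_algebra_1 \<Rightarrow> 'a \<Rightarrow> bool" where
  "mvn_equiv p q \<longleftrightarrow> (\<exists>v. star v * v = p \<and> v * star v = q)"

definition subprojection :: "'a::cstar_algebra_1 \<Rightarrow> 'a \<Rightarrow> bool" where
  "subprojection e p \<longleftrightarrow> projection e \<and> projection p \<and> p * e = e"

definition properly_infinite :: "'a::cstar_algebra_1 \<Rightarrow> bool" where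
  "properly_infinite p \<longleftrightarrow> projection p \<and> p \<noteq> 0 \<and>
     (\<exists>e f. subprojection e p \<and> subprojection f p \<and> e * f = 0 \<and> mvn_equiv e p \<and> mvn_equiv f p)"

definition closed_ideal :: "'a::cstar_algebra_1 set \<Rightarrow> 'a set \<Rightarrow> bool" where
  "closed_ideal A J \<longleftrightarrow> J \<subseteq> A \<and> closed J \<and> 0 \<in> J \<and>
     (\<forall>a\<in>J. \<forall>b\<in>J. a + b \<in> J) \<and> (\<forall>z. \<forall>a\<in>J. z *\<^sub>C a \<in> J) \<and>
     (\<forall>a\<in>A. \<forall>b\<in>J. a * b \<in> J \<and> b * a \<in> J)"

definition full :: "'a::cstar_algebra_1 \<Rightarrow> bool" where
  "full p \<longleftrightarrow> (\<forall>J. closed_ideal UNIV J \<and> p \<in> J \<longrightarrow> J = UNIV)"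

definition simple_cstar :: "'a::cstar_algebra_1 set \<Rightarrow> bool" where
  "simple_cstar A \<longleftrightarrow> A \<noteq> {0} \<and> (\<forall>J. closed_ideal A J \<longrightarrow> J = {0} \<or> J = A)"

definition real_rank_zero :: "'a::cstar_algebra_1 itself \<Rightarrow> bool" where
  "real_rank_zero _ \<longleftrightarrow>
     {a::'a. star a = a} \<subseteq> closure {a. star a = a \<and> (\<exists>b. a * b = 1 \<and> b * a = 1)}"


section \<open>Multiplier algebras and the strict topology\<close>

definition double_centralizer ::
    "'a::cstar_algebra_1 set \<Rightarrow> ('a \<Rightarrow> 'a) \<Rightarrow> ('a \<Rightarrow> 'a) \<Rightarrow> bool" where
  "double_centralizer B L R \<longleftrightarrow> L ` B \<subseteq> B \<and> R ` B \<subseteq> B \<and> (\<forall>a\<in>B. \<forall>b\<in>B. a * L b = R a * b)"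

text \<open>
  The ambient type is the multiplier algebra of its closed ideal \<open>B\<close>: the canonical map
  \<open>m \<mapsto> (\<lambda>b. m * b, \<lambda>b. b * m)\<close> into the algebra of double centralizers of \<open>B\<close> is bijective.
  Linearity and boundedness of double centralizers are automatic, and so is \<open>star ` B = B\<close>.
\<close>

definition is_multiplier_algebra_of :: "'a::cstar_algebra_1 set \<Rightarrow> bool" where
  "is_multiplier_algebra_of B \<longleftrightarrow> closed_ideal UNIV B \<and>
     (\<forall>L R. double_centralizer B L R \<longrightarrow> (\<exists>!m. \<forall>b\<in>B. m * b = L b \<and> b * m = R b))"

definition strict_continuous_on ::
    "'a::cstar_algebra_1 set \<Rightarrow> 'x::topological_space set \<Rightarrow> ('x \<Rightarrow> 'a) \<Rightarrow> bool" where
  "strict_continuous_on B S f \<longleftrightarrow>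
     (\<forall>b\<in>B. continuous_on S (\<lambda>x. f x * b) \<and> continuous_on S (\<lambda>x. b * f x))"


section \<open>Infinite matrices with finite support\<close>

definition M_inf :: "'a::cstar_algebra_1 set \<Rightarrow> (nat \<Rightarrow> nat \<Rightarrow> 'a) set" where
  "M_inf A = {a. (\<forall>i j. a i j \<in> A) \<and> finite {(i, j). a i j \<noteq> 0}}"

definition mat_add :: "(nat \<Rightarrow> nat \<Rightarrow> 'a::cstar_algebra_1) \<Rightarrow> (nat \<Rightarrow> nat \<Rightarrow> 'a) \<Rightarrow> nat \<Rightarrow> nat \<Rightarrow> 'a" where
  "mat_add a b = (\<lambda>i j. a i j + b i j)"

definition mat_scale :: "complex \<Rightarrow> (nat \<Rightarrow> nat \<Rightarrow> 'a::cstar_algebra_1) \<Rightarrow> nat \<Rightarrow> nat \<Rightarrow> 'a" where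
  "mat_scale z a = (\<lambda>i j. z *\<^sub>C a i j)"

definition mat_mult :: "(nat \<Rightarrow> nat \<Rightarrow> 'a::cstar_algebra_1) \<Rightarrow> (nat \<Rightarrow> nat \<Rightarrow> 'a) \<Rightarrow> nat \<Rightarrow> nat \<Rightarrow> 'a" where
  "mat_mult a b = (\<lambda>i j. \<Sum>k | a i k \<noteq> 0. a i k * b k j)"

definition mat_star :: "(nat \<Rightarrow> nat \<Rightarrow> 'a::cstar_algebra_1) \<Rightarrow> nat \<Rightarrow> nat \<Rightarrow> 'a" where
  "mat_star a = (\<lambda>i j. star (a j i))"

definition mat_zero :: "nat \<Rightarrow> nat \<Rightarrow> 'a::cstar_algebra_1" where
  "mat_zero = (\<lambda>i j. 0)"

definition mat_corner :: "'a::cstar_algebra_1 \<Rightarrow> nat \<Rightarrow> nat \<Rightarrow> 'a" where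
  "mat_corner a = (\<lambda>i j. if i = 0 \<and> j = 0 then a else 0)"

text \<open>
  The direct sum puts \<open>a\<close> on the even and \<open>b\<close> on the odd coordinates, because a finitely
  supported matrix has no preferred size; a permutation of the coordinates turns it into the
  usual block diagonal sum.
\<close>

definition mat_oplus :: "(nat \<Rightarrow> nat \<Rightarrow> 'a::cstar_algebra_1) \<Rightarrow> (nat \<Rightarrow> nat \<Rightarrow> 'a) \<Rightarrow> nat \<Rightarrow> nat \<Rightarrow> 'a" where
  "mat_oplus a b = (\<lambda>i j.
     if even i \<and> even j then a (i div 2) (j div 2)
     else if odd i \<and> odd j then b (i div 2) (j div 2)
     else 0)"

text \<open>
  \<open>B\<close> is isomorphic to \<open>B \<otimes> \<K>\<close>. The latter is the completion of \<open>M_inf B\<close>, the union of the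
  \<open>M\<^sub>n(B)\<close>, in its unique C*-norm; hence an isomorphism amounts to an injective *-homomorphism
  from \<open>M_inf B\<close> onto a dense subset of \<open>B\<close>.
\<close>

definition stable_cstar :: "'a::cstar_algebra_1 set \<Rightarrow> bool" where
  "stable_cstar B \<longleftrightarrow> (\<exists>\<theta>.
     \<theta> ` M_inf B \<subseteq> B \<and> inj_on \<theta> (M_inf B) \<and> B \<subseteq> closure (\<theta> ` M_inf B) \<and>
     (\<forall>a\<in>M_inf B. \<forall>b\<in>M_inf B. \<theta> (mat_add a b) = \<theta> a + \<theta> b \<and> \<theta> (mat_mult a b) = \<theta> a * \<theta> b) \<and>
     (\<forall>z. \<forall>a\<in>M_inf B. \<theta> (mat_scale z a) = z *\<^sub>C \<theta> a) \<and>
     (\<forall>a\<in>M_inf B. \<theta> (mat_star a) = star (\<theta> a)))"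


section \<open>The group $K_0$\<close>

type_synonym 'a K0_elem = "((nat \<Rightarrow> nat \<Rightarrow> 'a) \<times> (nat \<Rightarrow> nat \<Rightarrow> 'a)) set"

definition Proj_inf :: "'a::cstar_algebra_1 set \<Rightarrow> (nat \<Rightarrow> nat \<Rightarrow> 'a) set" where
  "Proj_inf A = {p \<in> M_inf A. mat_mult p p = p \<and> mat_star p = p}"

definition mvn_equiv_inf ::
    "'a::cstar_algebra_1 set \<Rightarrow> (nat \<Rightarrow> nat \<Rightarrow> 'a) \<Rightarrow> (nat \<Rightarrow> nat \<Rightarrow> 'a) \<Rightarrow> bool" where
  "mvn_equiv_inf A p q \<longleftrightarrow>
     (\<exists>v\<in>M_inf A. mat_mult (mat_star v) v = p \<and> mat_mult v (mat_star v) = q)"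

text \<open>
  For a unital C*-subalgebra \<open>A\<close>, the Grothendieck group of the monoid of Murray-von Neumann
  classes of projections over \<open>A\<close>. The pair \<open>(p, q)\<close> stands for the formal difference of the
  classes of \<open>p\<close> and \<open>q\<close>; the group is written multiplicatively, as usual in HOL-Algebra.
\<close>

definition K00_rel :: "'a::cstar_algebra_1 set \<Rightarrow>
    (((nat \<Rightarrow> nat \<Rightarrow> 'a) \<times> (nat \<Rightarrow> nat \<Rightarrow> 'a)) \<times> ((nat \<Rightarrow> nat \<Rightarrow> 'a) \<times> (nat \<Rightarrow> nat \<Rightarrow> 'a))) set" where
  "K00_rel A = {((p, q), (p', q')).
     p \<in> Proj_inf A \<and> q \<in> Proj_inf A \<and> p' \<in> Proj_inf A \<and> q' \<in> Proj_inf A \<and>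
     (\<exists>r\<in>Proj_inf A.
        mvn_equiv_inf A (mat_oplus (mat_oplus p q') r) (mat_oplus (mat_oplus p' q) r))}"

definition K00_class ::
    "'a::cstar_algebra_1 set \<Rightarrow> (nat \<Rightarrow> nat \<Rightarrow> 'a) \<Rightarrow> (nat \<Rightarrow> nat \<Rightarrow> 'a) \<Rightarrow> 'a K0_elem" where
  "K00_class A p q = K00_rel A `` {(p, q)}"

definition K00 :: "'a::cstar_algebra_1 set \<Rightarrow> 'a K0_elem monoid" where
  "K00 A = \<lparr>carrier = (Proj_inf A \<times> Proj_inf A) // K00_rel A,
     mult = (\<lambda>U V. \<Union>(p, q)\<in>U. \<Union>(p', q')\<in>V. K00_class A (mat_oplus p p') (mat_oplus q q')),
     one = K00_class A mat_zero mat_zero\<rparr>"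

text \<open>
  The unitization of a nonunital closed ideal \<open>B\<close>, and the scalar map from it to the complex
  numbers. The group \<open>K0 B\<close> is the kernel of the map induced by the scalar map.
\<close>

definition unitization :: "'a::cstar_algebra_1 set \<Rightarrow> 'a set" where
  "unitization B = {b + z *\<^sub>C 1 | b z. b \<in> B}"

definition scalar_part :: "'a::cstar_algebra_1 set \<Rightarrow> 'a \<Rightarrow> complex" where
  "scalar_part B a = (THE z. a - z *\<^sub>C 1 \<in> B)"

definition K00_scalar_map :: "'a::cstar_algebra_1 set \<Rightarrow> 'a K0_elem \<Rightarrow> complex K0_elem" where
  "K00_scalar_map B U =
     (\<Union>(p, q)\<in>U. K00_class UNIV (\<lambda>i j. scalar_part B (p i j)) (\<lambda>i j. scalar_part B (q i j)))"

definition K0 :: "'a::cstar_algebra_1 set \<Rightarrow> 'a K0_elem monoid" where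
  "K0 B = (K00 (unitization B))
     \<lparr>carrier := kernel (K00 (unitization B)) (K00 UNIV) (K00_scalar_map B)\<rparr>"

definition K0_class :: "'a::cstar_algebra_1 set \<Rightarrow> 'a \<Rightarrow> 'a K0_elem" where
  "K0_class B p = K00_class (unitization B) (mat_corner p) mat_zero"

definition K0_diff :: "'a::cstar_algebra_1 set \<Rightarrow> 'a K0_elem \<Rightarrow> 'a K0_elem \<Rightarrow> 'a K0_elem" where
  "K0_diff B a b = a \<otimes>\<^bsub>K0 B\<^esub> inv\<^bsub>K0 B\<^esub> b"

text \<open>The common class of the values of a norm continuous projection valued function.\<close>

definition K0_class_on :: "'a::cstar_algebra_1 set \<Rightarrow> 'x set \<Rightarrow> ('x \<Rightarrow> 'a) \<Rightarrow> 'a K0_elem" where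
  "K0_class_on B S r = (THE k. \<forall>x\<in>S. K0_class B (r x) = k)"


section \<open>Cuntz pairs and essential codimension\<close>

type_synonym 'a cpair = "(complex \<Rightarrow> 'a) \<times> (complex \<Rightarrow> 'a)"

definition Cuntz_pairs :: "'a::cstar_algebra_1 set \<Rightarrow> 'a cpair set" where
  "Cuntz_pairs B = {(\<phi>, \<psi>). star_hom \<phi> \<and> star_hom \<psi> \<and> (\<forall>z. \<phi> z - \<psi> z \<in> B)}"

definition Cuntz_homotopy :: "'a::cstar_algebra_1 set \<Rightarrow> ('a cpair \<times> 'a cpair) set" where
  "Cuntz_homotopy B = {((\<phi>\<^sub>0, \<psi>\<^sub>0), (\<phi>\<^sub>1, \<psi>\<^sub>1)). \<exists>\<phi> \<psi> :: real \<Rightarrow> complex \<Rightarrow> 'a.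
     (\<forall>t\<in>{0..1}. (\<phi> t, \<psi> t) \<in> Cuntz_pairs B) \<and>
     \<phi> 0 = \<phi>\<^sub>0 \<and> \<psi> 0 = \<psi>\<^sub>0 \<and> \<phi> 1 = \<phi>\<^sub>1 \<and> \<psi> 1 = \<psi>\<^sub>1 \<and>
     (\<forall>z. strict_continuous_on B {0..1} (\<lambda>t. \<phi> t z) \<and>
          strict_continuous_on B {0..1} (\<lambda>t. \<psi> t z) \<and>
          continuous_on {0..1} (\<lambda>t. \<phi> t z - \<psi> t z))}"

definition Cuntz_class :: "'a::cstar_algebra_1 set \<Rightarrow> 'a cpair \<Rightarrow> 'a cpair set" where
  "Cuntz_class B c = Cuntz_homotopy B `` {c}"

definition Cuntz_sum :: "'a::cstar_algebra_1 \<Rightarrow> 'a \<Rightarrow> 'a cpair \<Rightarrow> 'a cpair \<Rightarrow> 'a cpair" where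
  "Cuntz_sum s t = (\<lambda>(\<phi>, \<psi>) (\<phi>', \<psi>').
     (\<lambda>z. s * \<phi> z * star s + t * \<phi>' z * star t, \<lambda>z. s * \<psi> z * star s + t * \<psi>' z * star t))"

text \<open>
  Cuntz's picture of \<open>KK(\<complex>, B)\<close> for stable \<open>B\<close>: homotopy classes of Cuntz pairs, with the
  direct sum brought back into the multiplier algebra by isometries \<open>s\<close> and \<open>t\<close> whose range
  projections add up to the unit. The class of the sum does not depend on \<open>s\<close> and \<open>t\<close>.
\<close>

definition KK_complex :: "'a::cstar_algebra_1 set \<Rightarrow> 'a cpair set monoid" where
  "KK_complex B = \<lparr>carrier = Cuntz_pairs B // Cuntz_homotopy B,
     mult = (\<lambda>U V. \<Union>c\<in>U. \<Union>d\<in>V.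
        \<Union>(s, t)\<in>{(s, t). star s * s = 1 \<and> star t * t = 1 \<and> s * star s + t * star t = 1}.
          Cuntz_class B (Cuntz_sum s t c d)),
     one = Cuntz_class B (\<lambda>_. 0, \<lambda>_. 0)\<rparr>"

text \<open>The Cuntz pair \<open>(\<phi>, \<psi>)\<close> with \<open>\<phi>(1) = p\<close> and \<open>\<psi>(1) = q\<close>.\<close>

definition pair_of_projections :: "'a::cstar_algebra_1 \<Rightarrow> 'a \<Rightarrow> 'a cpair" where
  "pair_of_projections p q = (\<lambda>z. z *\<^sub>C p, \<lambda>z. z *\<^sub>C q)"

text \<open>
  \<open>\<Phi>\<close> is the isomorphism between \<open>KK(\<complex>, B)\<close> and \<open>K\<^sub>0(B)\<close>, fixed by its values on pairs of
  projections in \<open>B\<close>. If \<open>B\<close> is stable and has an approximate unit of projections (as it does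
  when its multiplier algebra has real rank zero), such pairs exhaust \<open>KK(\<complex>, B)\<close>, so that \<open>\<Phi>\<close>
  is unique.
\<close>

definition KK_K0_iso ::
    "'a::cstar_algebra_1 set \<Rightarrow> ('a cpair set \<Rightarrow> 'a K0_elem) \<Rightarrow> bool" where
  "KK_K0_iso B \<Phi> \<longleftrightarrow> group (KK_complex B) \<and> group (K0 B) \<and> \<Phi> \<in> iso (KK_complex B) (K0 B) \<and>
     (\<forall>p\<in>B. \<forall>q\<in>B. projection p \<and> projection q \<longrightarrow>
        \<Phi> (Cuntz_class B (pair_of_projections p q)) = K0_diff B (K0_class B p) (K0_class B q))"

definition ess_codim :: "'a::cstar_algebra_1 set \<Rightarrow> ('a cpair set \<Rightarrow> 'a K0_elem) \<Rightarrow>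
    'a \<Rightarrow> 'a \<Rightarrow> 'a K0_elem" where
  "ess_codim B \<Phi> p q = \<Phi> (Cuntz_class B (pair_of_projections p q))"


section \<open>Multiplier and corona algebras of $C_0(X) \otimes B$\<close>

text \<open>
  Functions on \<open>S\<close> are represented by functions on the real line whose values outside \<open>S\<close> are
  irrelevant. A function that vanishes on \<open>S\<close> belongs to \<open>C0_norm B S\<close>, so this does not
  affect the corona algebras. If \<open>S\<close> is compact, the condition at infinity is void.
\<close>

definition Cb_strict :: "'a::cstar_algebra_1 set \<Rightarrow> real set \<Rightarrow> (real \<Rightarrow> 'a) set" where
  "Cb_strict B S = {f. bounded (f ` S) \<and> strict_continuous_on B S f}"

definition C0_norm :: "'a::cstar_algebra_1 set \<Rightarrow> real set \<Rightarrow> (real \<Rightarrow> 'a) set" where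
  "C0_norm B S = {f. f ` S \<subseteq> B \<and> continuous_on S f \<and> (f \<longlongrightarrow> 0) (inf at_infinity (principal S))}"

definition fun_ring :: "(real \<Rightarrow> 'a::cstar_algebra_1) set \<Rightarrow> (real \<Rightarrow> 'a) ring" where
  "fun_ring M = \<lparr>carrier = M, mult = (\<lambda>f g x. f x * g x), one = (\<lambda>_. 1),
     zero = (\<lambda>_. 0), add = (\<lambda>f g x. f x + g x)\<rparr>"

definition quot_map ::
    "(real \<Rightarrow> 'a::cstar_algebra_1) set \<Rightarrow> (real \<Rightarrow> 'a) set \<Rightarrow> (real \<Rightarrow> 'a) \<Rightarrow> (real \<Rightarrow> 'a) set" where
  "quot_map M J f = J +>\<^bsub>fun_ring M\<^esub> f"

definition coset_star :: "(real \<Rightarrow> 'a::cstar_algebra_1) set \<Rightarrow> (real \<Rightarrow> 'a) set" where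
  "coset_star U = (\<lambda>f x. star (f x)) ` U"

datatype base_space = Unit_Interval | Half_Line | Line | Circle

text \<open>The circle is \<open>[0,1]\<close> with its end points identified.\<close>

fun points :: "base_space \<Rightarrow> real set" where
  "points Unit_Interval = {0..1}"
| "points Half_Line = {0..}"
| "points Line = UNIV"
| "points Circle = {0..1}"

definition mult_I :: "'a::cstar_algebra_1 set \<Rightarrow> base_space \<Rightarrow> (real \<Rightarrow> 'a) set" where
  "mult_I B X = {f \<in> Cb_strict B (points X). X = Circle \<longrightarrow> f 0 = f 1}"

definition ideal_I :: "'a::cstar_algebra_1 set \<Rightarrow> base_space \<Rightarrow> (real \<Rightarrow> 'a) set" where
  "ideal_I B X = {f \<in> C0_norm B (points X). X = Circle \<longrightarrow> f 0 = f 1}"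

definition corona :: "'a::cstar_algebra_1 set \<Rightarrow> base_space \<Rightarrow> (real \<Rightarrow> 'a) set ring" where
  "corona B X = fun_ring (mult_I B X) Quot ideal_I B X"

definition corona_projection ::
    "'a::cstar_algebra_1 set \<Rightarrow> base_space \<Rightarrow> (real \<Rightarrow> 'a) set \<Rightarrow> bool" where
  "corona_projection B X P \<longleftrightarrow>
     P \<in> carrier (corona B X) \<and> P \<otimes>\<^bsub>corona B X\<^esub> P = P \<and> coset_star P = P"

definition corona_mvn_equiv ::
    "'a::cstar_algebra_1 set \<Rightarrow> base_space \<Rightarrow> (real \<Rightarrow> 'a) set \<Rightarrow> (real \<Rightarrow> 'a) set \<Rightarrow> bool" where
  "corona_mvn_equiv B X P Q \<longleftrightarrow> (\<exists>V\<in>carrier (corona B X).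
     coset_star V \<otimes>\<^bsub>corona B X\<^esub> V = P \<and> V \<otimes>\<^bsub>corona B X\<^esub> coset_star V = Q)"


section \<open>Local liftings\<close>

text \<open>The partition points are \<open>x 1 < \<dots> < x n\<close>; the other values of \<open>x\<close> are irrelevant.\<close>

definition is_partition :: "base_space \<Rightarrow> nat \<Rightarrow> (nat \<Rightarrow> real) \<Rightarrow> bool" where
  "is_partition X n x \<longleftrightarrow> x ` {1..n} \<subseteq> interior (points X) \<and> strict_mono_on {1..n} x"

definition piece :: "base_space \<Rightarrow> nat \<Rightarrow> (nat \<Rightarrow> real) \<Rightarrow> nat \<Rightarrow> real set" where
  "piece X n x i = {s \<in> points X. (1 \<le> i \<longrightarrow> x i \<le> s) \<and> (i < n \<longrightarrow> s \<le> x (Suc i))}"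

definition local_tuple :: "'a::cstar_algebra_1 set \<Rightarrow> base_space \<Rightarrow> nat \<Rightarrow> (nat \<Rightarrow> real) \<Rightarrow>
    (nat \<Rightarrow> real \<Rightarrow> 'a) \<Rightarrow> bool" where
  "local_tuple B X n x f \<longleftrightarrow>
     (\<forall>i\<le>n. f i \<in> Cb_strict B (piece X n x i)) \<and>
     (\<forall>i\<in>{1..n}. f i (x i) - f (i - 1) (x i) \<in> B) \<and>
     (X = Circle \<longrightarrow> f 0 0 - f n 1 \<in> B)"

definition represented_element :: "'a::cstar_algebra_1 set \<Rightarrow> base_space \<Rightarrow> nat \<Rightarrow>
    (nat \<Rightarrow> real) \<Rightarrow> (nat \<Rightarrow> real \<Rightarrow> 'a) \<Rightarrow> (real \<Rightarrow> 'a) set" where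
  "represented_element B X n x f =
     {g \<in> mult_I B X. \<forall>i\<le>n. (\<lambda>s. g s - f i s) \<in> C0_norm B (piece X n x i)}"

definition local_lifting :: "'a::cstar_algebra_1 set \<Rightarrow> base_space \<Rightarrow> nat \<Rightarrow> (nat \<Rightarrow> real) \<Rightarrow>
    (real \<Rightarrow> 'a) set \<Rightarrow> (nat \<Rightarrow> real \<Rightarrow> 'a) \<Rightarrow> bool" where
  "local_lifting B X n x P p \<longleftrightarrow>
     local_tuple B X n x p \<and> P = represented_element B X n x p \<and>
     (\<forall>i\<le>n. \<forall>s\<in>piece X n x i. projection (p i s))"

text \<open>
  The partial isometries \<open>T 0, \<dots>, T n\<close> arise from one choice of \<open>u\<close> that implements the
  equivalence of \<open>P\<close> and \<open>Q\<close>, and from choices of \<open>v\<close>, \<open>w\<close> and \<open>ut\<close> (a partial isometry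
  lifting the image of \<open>w u\<^sub>i v\<close> in the corona algebra) on each piece.
\<close>

definition associated_isometries :: "'a::cstar_algebra_1 set \<Rightarrow> base_space \<Rightarrow> nat \<Rightarrow>
    (nat \<Rightarrow> real) \<Rightarrow> (real \<Rightarrow> 'a) set \<Rightarrow> (real \<Rightarrow> 'a) set \<Rightarrow>
    (nat \<Rightarrow> real \<Rightarrow> 'a) \<Rightarrow> (nat \<Rightarrow> real \<Rightarrow> 'a) \<Rightarrow> (nat \<Rightarrow> real \<Rightarrow> 'a) \<Rightarrow> bool" where
  "associated_isometries B X n x P Q p q T \<longleftrightarrow>
     (\<exists>u\<in>mult_I B X.
        (let U = quot_map (mult_I B X) (ideal_I B X) u
         in coset_star U \<otimes>\<^bsub>corona B X\<^esub> U = P \<and> U \<otimes>\<^bsub>corona B X\<^esub> coset_star U = Q) \<and>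
        (\<forall>i\<le>n.
          (let S = piece X n x i;
               M = Cb_strict B S;
               \<pi> = quot_map M (C0_norm B S);
               u\<^sub>i = (\<lambda>s. q i s * u s * p i s)
           in \<exists>v\<in>M. \<exists>w\<in>M. \<exists>ut\<in>M.
                (\<forall>s\<in>S. star (v s) * v s = 1 \<and> v s * star (v s) = p i s \<and>
                       w s * star (w s) = 1 \<and> star (w s) * w s = q i s \<and>
                       partial_isometry (ut s)) \<and>
                \<pi> ut = \<pi> (\<lambda>s. w s * u\<^sub>i s * v s) \<and>
                T i \<in> M \<and> (\<forall>s\<in>S. T i s = star (w s) * ut s * star (v s)))))"

definition defect_class :: "'a::cstar_algebra_1 set \<Rightarrow> real set \<Rightarrow>
    (real \<Rightarrow> 'a) \<Rightarrow> (real \<Rightarrow> 'a) \<Rightarrow> (real \<Rightarrow> 'a) \<Rightarrow> 'a K0_elem" where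
  "defect_class B S p q T = K0_diff B
     (K0_class_on B S (\<lambda>s. p s - star (T s) * T s))
     (K0_class_on B S (\<lambda>s. q s - T s * star (T s)))"

end

theory Submission
  imports Defs
begin

text \<open>
  For projections \<open>f \<le> e\<close> with \<open>e - f \<in> B\<close>, the Cuntz pair \<open>(e, f)\<close> is the sum of
  \<open>(e - f, 0)\<close> and the degenerate pair \<open>(f, f)\<close>. The usual proof discards degenerate pairs by a
  strict homotopy; here they are cancelled instead. After adding the zero pair, \<open>e\<close> and \<open>f\<close> live
  in the first half of the unit, which is split by isometries \<open>s\<close> and \<open>t\<close>. If \<open>T\<close> is a partial
  isometry from \<open>f\<close> onto \<open>f'\<close>, a norm continuous rotation of \<open>s * f\<close> into \<open>t * T\<close> shows
  \<open>[e : f] = [e - f : 0] + [f' : f']\<close>. The same holds for \<open>f' \<le> e'\<close> with the same degenerate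
  summand \<open>[f' : f']\<close>, so the difference of the two essential codimensions is
  \<open>[e - f]\<^sub>0 - [e' - f']\<^sub>0\<close>. For \<open>e = p\<^sub>i\<close> and \<open>e' = q\<^sub>i\<close> the defects \<open>e - f\<close>, \<open>e' - f'\<close> are
  norm continuous and \<open>B\<close>-valued because \<open>u\<close> implements the equivalence modulo the ideal;
  so their classes do not depend on the point.
\<close>

section \<open>Elementary facts about C*-algebras\<close>

text \<open>The isomorphism \<open>\<Phi>\<close> is prescribed only on pairs of projections inside
  \<open>B\<close>, whereas \<open>f\<close> and \<open>f'\<close> are merely multipliers; so the
  value at \<open>(f', f')\<close> is never evaluated. A norm continuous rotation suffices because
  both entries of the pair move together: their difference is the fixed image of
  \<open>e - f\<close> in \<open>B\<close>. The isometries \<open>s\<close> and \<open>t\<close> are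
  extracted from the group axioms of \<open>KK_complex B\<close>. The classes of the defects are
  locally constant because projections at distance at most 1/2 are equivalent through a partial
  isometry that stays in \<open>B\<close>; its inverse square root comes from a contraction instead
  of functional calculus. \<open>closed_ideal\<close> does not mention the adjoint, yet adjoints of
  elements of \<open>B\<close> are needed for the unitization and for the strict continuity of
  adjoints. The resolvent estimates serve to show that closed ideals are self-adjoint.\<close>

lemma star_zero [simp]: "star (0::'a::cstar_algebra_1) = 0"
  using star_add[of "0::'a" 0] by simp

lemma star_minus: "star (- a :: 'a::cstar_algebra_1) = - star a"
  using star_add[of a "- a"] by (simp add: eq_neg_iff_add_eq_0 add.commute)

lemma star_diff: "star (a - b :: 'a::cstar_algebra_1) = star a - star b"
  using star_add[of a "- b"] by (simp add: star_minus)

lemma star_one [simp]: "star (1::'a::cstar_algebra_1) = 1"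
  by (metis mult.left_neutral mult.right_neutral star_mult star_star)

lemma star_scaleR: "star (r *\<^sub>R a :: 'a::cstar_algebra_1) = r *\<^sub>R star a"
  by (metis complex_cnj_complex_of_real scaleC_of_real star_scaleC)

lemma norm_star [simp]: "norm (star a :: 'a::cstar_algebra_1) = norm a"
proof -
  have le: "norm b \<le> norm (star b)" for b :: 'a
  proof (cases "b = 0")
    case False
    have "norm b * norm b \<le> norm (star b) * norm b"
      using cstar_identity[of b] norm_mult_ineq[of "star b" b] by (simp add: power2_eq_square)
    then show ?thesis using False by simp
  qed simp
  from le[of a] le[of "star a"] show ?thesis by (simp add: star_star)
qed

lemma star_eq_zero_iff [simp]: "star (a::'a::cstar_algebra_1) = 0 \<longleftrightarrow> a = 0"
  by (metis norm_star norm_eq_zero)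

lemma star_mult_self_eq_zero: "star (a::'a::cstar_algebra_1) * a = 0 \<Longrightarrow> a = 0"
  using cstar_identity[of a] by simp

lemma scaleC_one [simp]: "1 *\<^sub>C (a::'a::cstar_algebra_1) = a"
  using scaleC_of_real[of 1 a] by simp

lemma scaleC_zero_left [simp]: "0 *\<^sub>C (a::'a::cstar_algebra_1) = 0"
  using scaleC_of_real[of 0 a] by simp

lemma scaleC_zero_right [simp]: "z *\<^sub>C (0::'a::cstar_algebra_1) = 0"
  using scaleC_add_right[of z "0::'a" 0] by simp

lemma scaleC_diff_right: "z *\<^sub>C (a - b :: 'a::cstar_algebra_1) = z *\<^sub>C a - z *\<^sub>C b"
  by (metis add_diff_cancel diff_add_cancel scaleC_add_right)

lemma scaleC_diff_left: "(y - z) *\<^sub>C (a :: 'a::cstar_algebra_1) = y *\<^sub>C a - z *\<^sub>C a"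
  by (metis add_diff_cancel diff_add_cancel scaleC_add_left)

lemma scaleC_minus_left: "(- z) *\<^sub>C (a :: 'a::cstar_algebra_1) = - (z *\<^sub>C a)"
  using scaleC_diff_left[of 0 z a] by simp

lemma bounded_linear_star: "bounded_linear (star :: 'a::cstar_algebra_1 \<Rightarrow> 'a)"
  by (rule bounded_linear_intro[where K = 1]) (auto simp: star_add star_scaleR)

lemmas continuous_on_star [continuous_intros] = bounded_linear.continuous_on[OF bounded_linear_star]

lemma scaleR_scaleC: "r *\<^sub>R (z *\<^sub>C a) = z *\<^sub>C (r *\<^sub>R (a::'a::cstar_algebra_1))"
  by (metis mult.commute scaleC_of_real scaleC_scaleC)

lemma bounded_linear_scaleC: "bounded_linear (\<lambda>a. z *\<^sub>C (a::'a::cstar_algebra_1))"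
  by (rule bounded_linear_intro[where K = "cmod z"])
    (auto simp: scaleC_add_right norm_scaleC mult.commute scaleR_scaleC)

lemma projection_zero [simp]: "projection (0::'a::cstar_algebra_1)"
  by (simp add: projection_def)

text \<open>With \<open>p = star v * v\<close>, the four terms of
  \<open>star (v * p - v) * (v * p - v)\<close> are all \<open>p\<close> up to sign and cancel; the
  C*-identity then gives \<open>v * p - v = 0\<close>.\<close>

lemma partial_isometry_mult_initial:
  assumes "projection (star v * v)"
  shows "v * (star v * v) = (v::'a::cstar_algebra_1)"
proof -
  define p where "p = star v * v"
  have p: "p * p = p" "star p = p" using assms by (auto simp: p_def projection_def)
  have "star (v * p - v) * (v * p - v) = p * p * p - p * p - p * p + p"
  proof -
    have "star (v * p - v) * (v * p - v) = (p * star v - star v) * (v * p - v)"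
      by (simp add: star_diff star_mult p)
    also have "\<dots> = p * (star v * v) * p - p * (star v * v) - (star v * v) * p + star v * v"
      by (simp add: algebra_simps)
    finally show ?thesis by (simp only: p_def[symmetric])
  qed
  then have "star (v * p - v) * (v * p - v) = 0" by (simp add: p)
  then show ?thesis using star_mult_self_eq_zero p_def by fastforce
qed

section \<open>Neumann series, resolvents and square roots\<close>

lemma neumann_inverse:
  fixes x :: "'a::{real_normed_algebra_1, banach}"
  assumes "norm x < 1"
  obtains y where "(1 - x) * y = 1" "y * (1 - x) = 1"
proof -
  have s: "summable (\<lambda>n. x ^ n)" using assms by (rule complete_algebra_summable_geometric)
  define y where "y = (\<Sum>n. x ^ n)"
  have "(\<lambda>n. x ^ n) sums y" using s by (simp add: y_def summable_sums)
  then have y: "y = 1 + (\<Sum>n. x ^ Suc n)"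
    using suminf_split_head[OF s] by (simp add: y_def)
  have "(\<Sum>n. x * x ^ n) = x * y" "(\<Sum>n. x ^ n * x) = y * x"
    using s by (simp_all add: y_def suminf_mult suminf_mult2[symmetric])
  then have "y = 1 + x * y" "y = 1 + y * x" using y by (simp_all add: power_commutes)
  then show ?thesis by (intro that[of y]) (simp_all add: algebra_simps)
qed

lemma neumann_inverse_scaleC:
  fixes x :: "'a::cstar_algebra_1"
  assumes "norm x < cmod z"
  obtains y where "(x + z *\<^sub>C 1) * y = 1" "y * (x + z *\<^sub>C 1) = 1"
proof -
  have z: "z \<noteq> 0" using assms by auto
  have "norm (- (inverse z *\<^sub>C x)) < 1"
    using assms z by (simp add: norm_scaleC norm_inverse norm_divide field_simps)
  from neumann_inverse[OF this] obtain y
    where y: "(1 + inverse z *\<^sub>C x) * y = 1" "y * (1 + inverse z *\<^sub>C x) = 1" by auto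
  have "x + z *\<^sub>C 1 = z *\<^sub>C (1 + inverse z *\<^sub>C x)"
    using z by (simp add: scaleC_add_right scaleC_scaleC)
  then show ?thesis
    using y z by (intro that[of "inverse z *\<^sub>C y"])
      (simp_all add: scaleC_mult_left scaleC_mult_right scaleC_scaleC)
qed

text \<open>The spectrum of a self-adjoint element is real: subtracting \<open>t\<close> times the
  imaginary unit raises the norm at most to the root of \<open>norm h ^ 2 + t ^ 2\<close>, which for
  large \<open>t\<close> is below the bound \<open>d + t\<close> that the Neumann series
  requires.\<close>

lemma self_adjoint_shift_invertible:
  fixes h :: "'a::cstar_algebra_1"
  assumes h: "star h = h" and d: "d > 0"
  obtains y where "(h + (\<i> * of_real d) *\<^sub>C 1) * y = 1" "y * (h + (\<i> * of_real d) *\<^sub>C 1) = 1"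
proof -
  \<comment> \<open>With this \<open>t\<close>,
    \<open>(d + t)^2 = d^2 + 2 * norm h ^ 2 + t^2\<close>, or \<open>d^2\<close> if
    \<open>h = 0\<close>; it exceeds \<open>norm h ^ 2 + t^2\<close> in either case.\<close>
  define t where "t = (norm h)\<^sup>2 / d"
  define x where "x = h - (\<i> * of_real t) *\<^sub>C 1"
  have t0: "t \<ge> 0" using d by (simp add: t_def)
  have "star x * x = h * h + (t\<^sup>2) *\<^sub>R 1"
    by (simp add: x_def star_diff star_scaleC h algebra_simps scaleC_mult_left scaleC_mult_right
        scaleC_scaleC scaleC_of_real[symmetric] power2_eq_square scaleC_diff_right
        scaleC_diff_left[symmetric] scaleC_add_left[symmetric])
  then have "(norm x)\<^sup>2 \<le> (norm h)\<^sup>2 + t\<^sup>2"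
    using cstar_identity[of x] norm_triangle_ineq[of "h * h" "(t\<^sup>2) *\<^sub>R 1"] norm_mult_ineq[of h h]
    by (simp add: power2_eq_square)
  also have "\<dots> < (d + t)\<^sup>2"
    using d t0 by (simp add: t_def power2_eq_square field_simps) (simp add: add_pos_nonneg)
  finally have "norm x < d + t" using d t0 by (simp add: power_less_imp_less_base)
  then have "norm x < cmod (\<i> * of_real (d + t))"
    using d t0 by (simp only: norm_mult norm_of_real norm_ii) simp
  from neumann_inverse_scaleC[OF this] obtain y
    where "(x + (\<i> * of_real (d + t)) *\<^sub>C 1) * y = 1" "y * (x + (\<i> * of_real (d + t)) *\<^sub>C 1) = 1" .
  moreover have "x + (\<i> * of_real (d + t)) *\<^sub>C 1 = h + (\<i> * of_real d) *\<^sub>C 1"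
    by (simp add: x_def algebra_simps scaleC_add_left)
  ultimately show ?thesis using that by metis
qed

lemma inverse_commute:
  fixes x :: "'a::monoid_mult"
  assumes "x * y = 1" "y * x = 1" "x * c = c * x"
  shows "y * c = c * y"
  by (metis assms mult.assoc mult.left_neutral mult.right_neutral)

text \<open>
  For self-adjoint \<open>h\<close> put \<open>R = (h + i d)\<inverse>\<close>. The Cayley transform \<open>(h - i d) R\<close> is a unitary
  \<open>U\<close>, and \<open>1 - U = 2 i d R\<close>, \<open>1 + U = 2 h R\<close> give the two bounds.
\<close>

lemma resolvent_bounds:
  fixes h :: "'a::cstar_algebra_1"
  assumes h: "star h = h" and d: "d > 0"
  obtains R where "R * h = h * R" "star R * h = h * star R" "star R * R = R * star R"
    "(h * h + d\<^sup>2 *\<^sub>R 1) * (R * star R) = 1" "norm R \<le> 1 / d" "norm (h * R) \<le> 1"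
proof -
  define c where "c = (\<i> * of_real d) *\<^sub>C (1::'a)"
  obtain R where R: "(h + c) * R = 1" "R * (h + c) = 1"
    using self_adjoint_shift_invertible[OF h d] unfolding c_def by blast
  have cc: "c * a = a * c" for a
    by (simp add: c_def scaleC_mult_left scaleC_mult_right)
  have sc: "star c = - c"
    by (simp add: c_def star_scaleC scaleC_minus_left)
  have c2: "c * c = - (d\<^sup>2 *\<^sub>R 1)"
  proof -
    have "(\<i> * of_real d) * (\<i> * of_real d) = - complex_of_real (d\<^sup>2)"
      by (simp add: complex_eq_iff power2_eq_square)
    then have "c * c = (- of_real (d\<^sup>2)) *\<^sub>C 1"
      by (simp only: c_def scaleC_mult_left scaleC_scaleC mult_1)
    then show ?thesis by (simp only: scaleC_minus_left scaleC_of_real)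
  qed
  have S: "star R * (h - c) = 1" "(h - c) * star R = 1"
    using arg_cong[OF R(1), of star] arg_cong[OF R(2), of star]
    by (simp_all add: star_mult star_add h sc)
  have comm: "(h - c) * (h + c) = (h + c) * (h - c)"
    by (simp add: algebra_simps cc[of h])
  have Rh: "R * h = h * R"
    using R by (rule inverse_commute) (simp add: algebra_simps cc[of h])
  have Sh: "star R * h = h * star R"
    using S(2,1) by (rule inverse_commute) (simp add: algebra_simps cc[of h])
  have RS: "star R * R = R * star R"
    using R by (rule inverse_commute[symmetric]) (simp add: algebra_simps cc[of "star R"] Sh)
  have inv: "(h * h + d\<^sup>2 *\<^sub>R 1) * (R * star R) = 1"
  proof -
    have "h * h + d\<^sup>2 *\<^sub>R 1 = (h - c) * (h + c)"
      using c2 by (simp add: algebra_simps cc[of h])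
    then have "(h * h + d\<^sup>2 *\<^sub>R 1) * (R * star R) = (h - c) * ((h + c) * R) * star R"
      by (simp add: mult.assoc)
    then show ?thesis using R S by simp
  qed
  define U where "U = (h - c) * R"
  have "star U * U = star R * ((h + c) * (h - c)) * R"
    by (simp add: U_def star_mult star_diff h sc mult.assoc)
  also have "\<dots> = star R * (h - c) * ((h + c) * R)"
    by (simp only: comm[symmetric] mult.assoc)
  also have "\<dots> = 1" using R S by simp
  finally have nU: "norm U = 1"
    using cstar_identity[of U] norm_ge_zero[of U] by (simp add: power2_eq_1_iff)
  have "1 - U = c * R + c * R"
    using R by (simp add: U_def algebra_simps)
  moreover have "c * R + c * R = (2 * \<i> * of_real d) *\<^sub>C R"
    by (simp add: c_def scaleC_mult_left scaleC_add_left[symmetric] mult.assoc)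
  ultimately have "norm (1 - U) = 2 * d * norm R"
    using d by (simp add: norm_scaleC norm_mult)
  then have b1: "norm R \<le> 1 / d"
    using norm_triangle_ineq4[of 1 U] nU d by (simp add: field_simps)
  have "1 + U = 2 *\<^sub>R (h * R)"
    using R by (simp add: U_def algebra_simps scaleR_2)
  then have "2 * norm (h * R) = norm (1 + U)" by simp
  then have b2: "norm (h * R) \<le> 1"
    using norm_triangle_ineq[of 1 U] nU unfolding norm_one by linarith
  show ?thesis using that Rh Sh RS inv b1 b2 by blast
qed

text \<open>Let \<open>h = b * star b\<close> and let \<open>N\<close> be the inverse of
  \<open>h * h + d^2\<close>. Then \<open>star b * h * h * N\<close> is in the ideal because
  \<open>h\<close> is, and it tends to \<open>star b\<close> as \<open>d\<close> tends to 0. So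
  \<open>h * h * N\<close> acts as an approximate unit.\<close>

lemma closed_ideal_star:
  fixes B :: "'a::cstar_algebra_1 set"
  assumes B: "closed_ideal UNIV B" and b: "b \<in> B"
  shows "star b \<in> B"
proof -
  define h where "h = b * star b"
  have hs: "star h = h" by (simp add: h_def star_mult star_star)
  have "\<exists>y\<in>B. dist y (star b) < e" if e: "e > 0" for e
  proof -
    \<comment> \<open>The squared error will be at most \<open>d ^ 4 * (1 / d ^ 3) = d\<close>, so
      any positive \<open>d\<close> below the square of \<open>e\<close> serves.\<close>
    define d where "d = e\<^sup>2 / 2"
    have d: "d > 0" using e by (simp add: d_def)
    obtain R where R: "R * h = h * R" "star R * h = h * star R" "star R * R = R * star R"
      "(h * h + d\<^sup>2 *\<^sub>R 1) * (R * star R) = 1" "norm R \<le> 1 / d" "norm (h * R) \<le> 1"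
      using resolvent_bounds[OF hs d] by blast
    define N where "N = R * star R"
    have Ns: "star N = N" by (simp add: N_def star_mult star_star)
    have hN: "h * N = N * h" unfolding N_def by (metis R(1,2) mult.assoc)
    have one: "h * (h * N) + d\<^sup>2 *\<^sub>R N = 1"
      using R(4) by (simp add: N_def algebra_simps)
    have hB: "h \<in> B" using B b by (auto simp: h_def closed_ideal_def)
    have yB: "star b * (h * (h * N)) \<in> B"
      using B hB by (simp add: closed_ideal_def)
    have diff: "star b - star b * (h * (h * N)) = d\<^sup>2 *\<^sub>R (star b * N)"
      using arg_cong[OF one, of "\<lambda>x. star b * x"] by (simp add: algebra_simps)
    \<comment> \<open>The C*-identity turns the error into \<open>N * h * N\<close>, regrouped as
      \<open>h * R\<close> of norm at most 1 and three factors \<open>R\<close> or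
      \<open>star R\<close> of norm at most \<open>1 / d\<close>.\<close>
    have "star (star b * N) * (star b * N) = N * h * N"
      by (simp add: star_mult star_star Ns h_def mult.assoc)
    also have "\<dots> = (h * R) * star R * (R * star R)"
      by (simp add: hN[symmetric]) (simp add: N_def mult.assoc)
    finally have "(norm (star b * N))\<^sup>2 = norm ((h * R) * star R * (R * star R))"
      using cstar_identity[of "star b * N"] by simp
    also have "\<dots> \<le> norm (h * R) * norm (star R) * (norm R * norm (star R))"
      by (meson norm_mult_ineq mult_mono norm_ge_zero order.trans mult_nonneg_nonneg mult_right_mono)
    also have "\<dots> \<le> 1 * (1 / d) * (1 / d * (1 / d))"
      using R d by (intro mult_mono) auto
    finally have n: "(norm (star b * N))\<^sup>2 \<le> 1 / d ^ 3"
      by (simp add: power3_eq_cube)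
    have "(norm (star b - star b * (h * (h * N))))\<^sup>2 = d ^ 4 * (norm (star b * N))\<^sup>2"
      by (simp add: diff power_mult_distrib power_mult[symmetric])
    also have "\<dots> \<le> d ^ 4 * (1 / d ^ 3)"
      using n by (intro mult_left_mono) auto
    also have "\<dots> < e\<^sup>2"
      using d e by (simp add: d_def power_numeral_reduce field_simps)
    finally have "norm (star b - star b * (h * (h * N))) < e"
      using e by (simp add: power_less_imp_less_base)
    then show ?thesis using yB by (intro bexI[of _ "star b * (h * (h * N))"]) (simp_all add: dist_norm norm_minus_commute)
  qed
  then have "star b \<in> closure B" by (auto simp: closure_approachable)
  then show ?thesis using B by (simp add: closed_ideal_def)
qed

text \<open>A fixed point \<open>y\<close> of the map \<open>y \<mapsto> (x + y * y) / 2\<close>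
  satisfies \<open>(1 - y) * (1 - y) = 1 - x\<close>, and \<open>z\<close> is the inverse of
  \<open>1 - y\<close>. The map contracts the ball of radius 1/2; the self-adjoint elements of this
  ball that commute with \<open>C\<close> form a closed invariant set, so the fixed point can be
  found there.\<close>

lemma inverse_sqrt_one_minus:
  fixes x :: "'a::cstar_algebra_1"
  assumes x: "star x = x" "norm x \<le> 1 / 2" and C: "\<And>c. c \<in> C \<Longrightarrow> c * x = x * c"
  obtains z where "star z = z" "z * z * (1 - x) = 1" "\<And>c. c \<in> C \<Longrightarrow> c * z = z * c" "z * x = x * z"
proof -
  \<comment> \<open>Adding \<open>x\<close> makes the fixed point, and with it \<open>z\<close>,
    commute with \<open>x\<close> as well.\<close>
  define C' where "C' = insert x C"
  define S where "S = {y::'a. norm y \<le> 1 / 2 \<and> star y = y \<and> (\<forall>c\<in>C'. c * y = y * c)}"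
  define f where "f = (\<lambda>y. (1 / 2) *\<^sub>R (x + y * y))"
  have "closed S"
  proof -
    have "closed {y::'a. norm y \<le> 1 / 2}" "closed {y::'a. star y = y}"
      "\<And>c. closed {y::'a. c * y = y * c}"
      by (intro closed_Collect_le closed_Collect_eq continuous_intros)+
    moreover have "S = {y. norm y \<le> 1 / 2} \<inter> {y. star y = y} \<inter> (\<Inter>c\<in>C'. {y. c * y = y * c})"
      by (auto simp: S_def)
    ultimately show ?thesis by (auto intro!: closed_Int closed_INT)
  qed
  then have "complete S" by (simp add: complete_eq_closed)
  moreover have "S \<noteq> {}" using x by (auto simp: S_def intro: exI[of _ 0])
  moreover have "f ` S \<subseteq> S"
  proof (rule image_subsetI)
    fix y assume "y \<in> S"
    then have y: "norm y \<le> 1 / 2" "star y = y" "\<forall>c\<in>C'. c * y = y * c" by (auto simp: S_def)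
    have "norm (y * y) \<le> 1 / 2 * (1 / 2)"
      using norm_mult_ineq[of y y] mult_mono[OF y(1) y(1)] by simp
    then have "norm (f y) \<le> 1 / 2"
      using norm_triangle_ineq[of x "y * y"] x by (simp add: f_def)
    moreover have "star (f y) = f y"
      using x y by (simp add: f_def star_scaleR star_add star_mult)
    moreover have "c * f y = f y * c" if c: "c \<in> C'" for c
    proof -
      have "c * x = x * c" using C c by (auto simp: C'_def)
      moreover have "c * (y * y) = y * y * c" using y c by (metis mult.assoc)
      ultimately have "c * (x + y * y) = (x + y * y) * c"
        by (simp only: distrib_left distrib_right)
      then show ?thesis by (simp add: f_def)
    qed
    ultimately show "f y \<in> S" by (simp add: S_def)
  qed
  moreover have "dist (f y) (f y') \<le> 1 / 2 * dist y y'" if "y \<in> S" "y' \<in> S" for y y'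
  proof -
    have n: "norm y \<le> 1 / 2" "norm y' \<le> 1 / 2" using that by (auto simp: S_def)
    have "f y - f y' = (1 / 2) *\<^sub>R (y * (y - y') + (y - y') * y')"
      by (simp add: f_def algebra_simps)
    then have "dist (f y) (f y') = 1 / 2 * norm (y * (y - y') + (y - y') * y')"
      by (simp add: dist_norm)
    also have "norm (y * (y - y') + (y - y') * y') \<le> norm y * norm (y - y') + norm (y - y') * norm y'"
      by (meson add_mono norm_mult_ineq norm_triangle_ineq order.trans)
    also have "\<dots> \<le> 1 / 2 * norm (y - y') + norm (y - y') * (1 / 2)"
      using n by (intro add_mono mult_mono) auto
    finally show ?thesis by (simp add: dist_norm)
  qed
  ultimately obtain y where y: "y \<in> S" "f y = y"
    using Banach_fix[of S "1 / 2" f] by auto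
  have "norm y < 1" using y by (simp add: S_def)
  from neumann_inverse[OF this] obtain z where z: "(1 - y) * z = 1" "z * (1 - y) = 1" .
  have "2 *\<^sub>R y = x + y * y" using y(2) by (metis f_def scaleR_half_double scaleR_2 scaleR_right_distrib)
  then have sq: "(1 - y) * (1 - y) = 1 - x" by (simp add: algebra_simps scaleR_2)
  have inv_unique: "w = z" if "w * (1 - y) = 1" for w
    using that z by (metis mult.assoc mult.left_neutral mult.right_neutral)
  have "star z * (1 - y) = 1"
    using arg_cong[OF z(1), of star] y by (simp add: star_mult star_diff S_def)
  then have "star z = z" by (rule inv_unique)
  moreover have "z * z * (1 - x) = 1"
    using z by (simp add: sq[symmetric]) (metis mult.assoc mult.right_neutral)
  moreover have "c * z = z * c" if "c \<in> C'" for c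
  proof -
    have "c * (1 - y) = (1 - y) * c" using y that by (simp add: S_def algebra_simps)
    then show ?thesis by (metis mult.assoc mult.left_neutral mult.right_neutral z)
  qed
  ultimately show ?thesis using that[of z] by (auto simp: C'_def)
qed

text \<open>The element \<open>x = (p - q) * (p - q)\<close> commutes with both projections, and
  \<open>p * q * p = (1 - x) * p\<close>, \<open>q * p * q = (1 - x) * q\<close>. Hence the inverse
  square root \<open>z\<close> of \<open>1 - x\<close> turns \<open>q * p\<close> into a partial
  isometry from \<open>p\<close> onto \<open>q\<close>. The form \<open>q * p * z\<close> shows that
  it lies in every ideal containing \<open>p\<close>.\<close>

lemma close_projections_equivalent:
  fixes p q :: "'a::cstar_algebra_1"
  assumes "projection p" "projection q" "norm (p - q) \<le> 1 / 2"
  obtains z where "star (q * p * z) * (q * p * z) = p" "q * p * z * star (q * p * z) = q"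
proof -
  note pq = assms(1,2)[unfolded projection_def]
  have idem: "p * (p * a) = p * a" "q * (q * a) = q * a" for a
    using pq by (metis mult.assoc)+
  define x where "x = (p - q) * (p - q)"
  have "norm x \<le> norm (p - q) * norm (p - q)"
    by (simp add: x_def norm_mult_ineq)
  also have "\<dots> \<le> 1 / 2 * (1 / 2)" using assms(3) by (intro mult_mono) auto
  finally have nx: "norm x \<le> 1 / 2" by simp
  have xs: "star x = x" using pq by (simp add: x_def star_mult star_diff)
  have px: "p * x = p - p * q * p" "x * p = p - p * q * p"
    and qx: "q * x = q - q * p * q" "x * q = q - q * p * q"
    using pq by (simp_all add: x_def algebra_simps) (simp_all add: mult.assoc[symmetric])
  have comm: "\<And>c. c \<in> {p, q} \<Longrightarrow> c * x = x * c" using px qx by auto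
  obtain z where z: "star z = z" "z * z * (1 - x) = 1" "\<And>c. c \<in> {p, q} \<Longrightarrow> c * z = z * c" "z * x = x * z"
    using inverse_sqrt_one_minus[OF xs nx comm, where C = "{p, q}"] by blast
  have zp: "p * z = z * p" and zq: "q * z = z * q" using z(3) by auto
  have "star (q * p * z) * (q * p * z) = z * (p * (q * q) * p) * z"
    using pq z(1) by (simp add: star_mult mult.assoc idem)
  also have "\<dots> = z * (p * q * p) * z" using pq by simp
  also have "p * q * p = (1 - x) * p" using px by (simp add: algebra_simps)
  also have "z * ((1 - x) * p) * z = z * z * (1 - x) * p"
  proof -
    have "(1 - x) * p * z = z * (1 - x) * p" using z(4) zp
      by (simp add: left_diff_distrib right_diff_distrib) (metis mult.assoc)
    then show ?thesis by (metis mult.assoc)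
  qed
  finally have 1: "star (q * p * z) * (q * p * z) = p" using z by simp
  have "q * p * z * star (q * p * z) = q * (p * z * z * p) * q"
    using pq z(1) by (simp add: star_mult mult.assoc idem)
  also have "\<dots> = z * z * (q * (p * p) * q)"
  proof -
    have "q * (p * z * z * p) * q = q * (z * z * p * p) * q" using zp by (metis mult.assoc)
    also have "\<dots> = z * z * q * p * p * q" using zq by (metis mult.assoc)
    finally show ?thesis by (simp add: mult.assoc)
  qed
  also have "\<dots> = z * z * (q * p * q)" using pq by simp
  also have "q * p * q = (1 - x) * q" using qx by (simp add: algebra_simps)
  finally have 2: "q * p * z * star (q * p * z) = q" using z by (simp add: mult.assoc[symmetric])
  from 1 2 show ?thesis by (rule that)
qed

section \<open>Finitely supported matrices\<close>

lemma M_inf_UNIV: "a \<in> M_inf A \<Longrightarrow> a \<in> M_inf UNIV"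
  by (simp add: M_inf_def)

lemma M_inf_finite_row:
  assumes "a \<in> M_inf A"
  shows "finite {k. a i k \<noteq> 0}"
proof -
  have "{k. a i k \<noteq> 0} \<subseteq> snd ` {(i, j). a i j \<noteq> 0}" by force
  then show ?thesis using assms by (auto simp: M_inf_def intro: finite_subset)
qed

text \<open>\<open>mat_mult\<close> sums over the support of row \<open>i\<close> of
  \<open>a\<close>, a set that varies with \<open>i\<close>; here it is exchanged for any finite
  \<open>K\<close> covering the indices at which both factors are nonzero. Finiteness of the row
  matters because a sum over an infinite set is 0 by convention.\<close>

lemma mat_mult_eq_sum:
  assumes "finite K" "\<And>k. a i k \<noteq> 0 \<Longrightarrow> b k j \<noteq> 0 \<Longrightarrow> k \<in> K"
    and "finite {k. a i k \<noteq> 0}"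
  shows "mat_mult a b i j = (\<Sum>k\<in>K. a i k * b k j)"
proof -
  have "mat_mult a b i j = (\<Sum>k\<in>{k. a i k \<noteq> 0} \<inter> K. a i k * b k j)"
    unfolding mat_mult_def using assms by (intro sum.mono_neutral_right) (auto, fastforce)
  also have "\<dots> = (\<Sum>k\<in>K. a i k * b k j)"
    using assms by (intro sum.mono_neutral_left) auto
  finally show ?thesis .
qed

lemma M_inf_bound:
  assumes "a \<in> M_inf A"
  obtains N where "\<And>i j. a i j \<noteq> 0 \<Longrightarrow> i < N \<and> j < N"
proof -
  define S where "S = fst ` {(i, j). a i j \<noteq> 0} \<union> snd ` {(i, j). a i j \<noteq> 0}"
  have "finite S" using assms by (simp add: S_def M_inf_def)
  then obtain N where "S \<subseteq> {..<N}" using finite_nat_bounded by auto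
  then have "\<And>i j. a i j \<noteq> 0 \<Longrightarrow> i < N \<and> j < N" by (force simp: S_def)
  then show ?thesis using that by blast
qed

lemma mat_mult_eq_sum_lessThan:
  assumes "a \<in> M_inf A" "\<And>i j. a i j \<noteq> 0 \<Longrightarrow> j < N"
  shows "mat_mult a b i j = (\<Sum>k<N. a i k * b k j)"
  using assms by (intro mat_mult_eq_sum M_inf_finite_row[OF assms(1)]) auto

lemma mat_mult_UNIV_closed:
  fixes a :: "nat \<Rightarrow> nat \<Rightarrow> 'a::cstar_algebra_1"
  assumes "a \<in> M_inf UNIV" "b \<in> M_inf UNIV"
  shows "mat_mult a b \<in> M_inf UNIV"
proof -
  obtain N where N: "\<And>i j. a i j \<noteq> 0 \<Longrightarrow> i < N \<and> j < N" using M_inf_bound[OF assms(1)] by blast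
  obtain M where M: "\<And>i j. b i j \<noteq> 0 \<Longrightarrow> i < M \<and> j < M" using M_inf_bound[OF assms(2)] by blast
  have "i < N \<and> j < M" if "mat_mult a b i j \<noteq> 0" for i j
  proof -
    have "(\<Sum>k | a i k \<noteq> 0. a i k * b k j) \<noteq> 0" using that by (simp add: mat_mult_def)
    then obtain k where "a i k * b k j \<noteq> 0" by (meson sum.neutral)
    then have "a i k \<noteq> 0" "b k j \<noteq> 0" by auto
    then show ?thesis using N M by blast
  qed
  then have "{(i, j). mat_mult a b i j \<noteq> 0} \<subseteq> {..<N} \<times> {..<M}" by auto
  then show ?thesis by (auto simp: M_inf_def intro: finite_subset)
qed

lemma mat_mult_assoc:
  assumes a: "a \<in> M_inf UNIV" and b: "b \<in> M_inf UNIV"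
  shows "mat_mult (mat_mult a b) c = mat_mult a (mat_mult b c)"
proof (intro ext)
  fix i j
  obtain N where N: "\<And>i j. a i j \<noteq> 0 \<Longrightarrow> i < N \<and> j < N" using M_inf_bound[OF a] by blast
  obtain M where M: "\<And>i j. b i j \<noteq> 0 \<Longrightarrow> i < M \<and> j < M" using M_inf_bound[OF b] by blast
  have ab: "mat_mult a b i j = (\<Sum>k<N. a i k * b k j)" for i j
    using N by (intro mat_mult_eq_sum_lessThan[OF a]) auto
  have bM: "b k j = 0" if "\<not> j < M" for k j using M that by blast
  have "mat_mult (mat_mult a b) c i j = (\<Sum>l<M. mat_mult a b i l * c l j)"
    by (rule mat_mult_eq_sum_lessThan[OF mat_mult_UNIV_closed[OF a b]])
      (auto simp: ab bM intro: ccontr)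
  also have "\<dots> = (\<Sum>l<M. \<Sum>k<N. a i k * b k l * c l j)"
    by (simp add: ab sum_distrib_right)
  also have "\<dots> = (\<Sum>k<N. \<Sum>l<M. a i k * b k l * c l j)" by (rule sum.swap)
  also have "\<dots> = (\<Sum>k<N. a i k * mat_mult b c k j)"
    using M by (simp add: mat_mult_eq_sum_lessThan[OF b, of M] sum_distrib_left mult.assoc)
  also have "\<dots> = mat_mult a (mat_mult b c) i j"
    using N by (simp add: mat_mult_eq_sum_lessThan[OF a, of N])
  finally show "mat_mult (mat_mult a b) c i j = mat_mult a (mat_mult b c) i j" .
qed

lemma mat_add_UNIV_closed:
  "a \<in> M_inf UNIV \<Longrightarrow> b \<in> M_inf UNIV \<Longrightarrow> mat_add a b \<in> M_inf UNIV"
  by (auto simp: M_inf_def mat_add_def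
      intro: finite_subset[of _ "{(i, j). a i j \<noteq> 0} \<union> {(i, j). b i j \<noteq> 0}"])

lemma mat_mult_add_right:
  "mat_mult a (mat_add b c) = mat_add (mat_mult a b) (mat_mult a c)"
  by (intro ext) (simp add: mat_mult_def mat_add_def distrib_left sum.distrib)

text \<open>The left factor determines the range of summation, and the row supports of
  \<open>a\<close>, \<open>b\<close> and their sum differ. A common bound for the supports brings
  the three sums to one index range.\<close>

lemma mat_mult_add_left:
  assumes a: "a \<in> M_inf UNIV" and b: "b \<in> M_inf UNIV"
  shows "mat_mult (mat_add a b) c = mat_add (mat_mult a c) (mat_mult b c)"
proof (intro ext)
  fix i j
  obtain N where N: "\<And>i j. a i j \<noteq> 0 \<Longrightarrow> i < N \<and> j < N" using M_inf_bound[OF a] by blast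
  obtain M where M: "\<And>i j. b i j \<noteq> 0 \<Longrightarrow> i < M \<and> j < M" using M_inf_bound[OF b] by blast
  let ?K = "max N M"
  have "mat_mult (mat_add a b) c i j = (\<Sum>k<?K. mat_add a b i k * c k j)"
    using N M by (intro mat_mult_eq_sum_lessThan[OF mat_add_UNIV_closed[OF a b]])
      (auto simp: mat_add_def less_max_iff_disj, metis add_0)
  moreover have "mat_mult a c i j = (\<Sum>k<?K. a i k * c k j)"
    using N by (intro mat_mult_eq_sum_lessThan[OF a]) (auto simp: less_max_iff_disj)
  moreover have "mat_mult b c i j = (\<Sum>k<?K. b i k * c k j)"
    using M by (intro mat_mult_eq_sum_lessThan[OF b]) (auto simp: less_max_iff_disj)
  ultimately show "mat_mult (mat_add a b) c i j = mat_add (mat_mult a c) (mat_mult b c) i j"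
    by (simp add: mat_add_def distrib_right sum.distrib)
qed

lemma mat_star_UNIV_closed:
  assumes "a \<in> M_inf UNIV"
  shows "mat_star a \<in> M_inf UNIV"
proof -
  have "{(i, j). mat_star a i j \<noteq> 0} = prod.swap ` {(i, j). a i j \<noteq> 0}"
    by (force simp: mat_star_def)
  then show ?thesis using assms by (simp add: M_inf_def)
qed

lemma mat_star_mult:
  assumes a: "a \<in> M_inf UNIV" and b: "b \<in> M_inf UNIV"
  shows "mat_star (mat_mult a b) = mat_mult (mat_star b) (mat_star a)"
proof (intro ext)
  fix i j
  obtain N where N: "\<And>i j. a i j \<noteq> 0 \<Longrightarrow> i < N \<and> j < N" using M_inf_bound[OF a] by blast
  have "mat_mult (mat_star b) (mat_star a) i j = (\<Sum>k<N. star (b k i) * star (a j k))"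
    unfolding mat_star_def
  proof (rule mat_mult_eq_sum)
    show "finite {k. star (b k i) \<noteq> 0}"
      using M_inf_finite_row[OF mat_star_UNIV_closed[OF b]] by (simp add: mat_star_def)
  qed (use N in auto)
  also have "\<dots> = star (\<Sum>k<N. a j k * b k i)"
    by (induction N) (auto simp: star_add star_mult)
  also have "(\<Sum>k<N. a j k * b k i) = mat_mult a b j i"
    using N by (simp add: mat_mult_eq_sum_lessThan[OF a, of N])
  finally show "mat_star (mat_mult a b) i j = mat_mult (mat_star b) (mat_star a) i j"
    by (simp add: mat_star_def)
qed

lemma mat_star_star [simp]: "mat_star (mat_star a) = a"
  by (simp add: mat_star_def star_star)

lemma mat_star_add: "mat_star (mat_add a b) = mat_add (mat_star a) (mat_star b)"
  by (simp add: mat_star_def mat_add_def star_add)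

lemma mat_star_zero [simp]: "mat_star mat_zero = mat_zero"
  by (simp add: mat_star_def mat_zero_def)

lemma mat_mult_zero [simp]: "mat_mult mat_zero a = mat_zero" "mat_mult a mat_zero = mat_zero"
  by (simp_all add: mat_mult_def mat_zero_def)

lemma mat_add_zero [simp]: "mat_add mat_zero a = a" "mat_add a mat_zero = a"
  by (simp_all add: mat_add_def mat_zero_def)

lemma mat_add_assoc: "mat_add (mat_add a b) c = mat_add a (mat_add b c)"
  by (simp add: mat_add_def add.assoc)

lemma mat_add_commute: "mat_add a b = mat_add b a"
  by (simp add: mat_add_def add.commute)

text \<open>For injective \<open>h\<close> and \<open>g\<close>, entry \<open>(k, l)\<close> of
  \<open>a\<close> moves to position \<open>(h k, g l)\<close>. This is multiplication on both sides
  by the isometries that \<open>h\<close> and \<open>g\<close> induce on the coordinates, whose own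
  matrices have infinite support and so are not in \<open>M_inf\<close>.\<close>

definition reindex :: "(nat \<Rightarrow> nat) \<Rightarrow> (nat \<Rightarrow> nat) \<Rightarrow> (nat \<Rightarrow> nat \<Rightarrow> 'a::cstar_algebra_1) \<Rightarrow> nat \<Rightarrow> nat \<Rightarrow> 'a"
  where "reindex h g a i j = (if i \<in> range h \<and> j \<in> range g then a (inv_into UNIV h i) (inv_into UNIV g j) else 0)"

lemma reindex_UNIV_closed:
  assumes "a \<in> M_inf UNIV" "inj h" "inj g"
  shows "reindex h g a \<in> M_inf UNIV"
proof -
  have "{(i, j). reindex h g a i j \<noteq> 0} \<subseteq> (\<lambda>(i, j). (h i, g j)) ` {(i, j). a i j \<noteq> 0}"
    using assms by (auto simp: reindex_def image_iff split: if_splits)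
  then show ?thesis using assms by (auto simp: M_inf_def intro: finite_subset)
qed

lemma reindex_id [simp]: "reindex id id a = a"
  by (intro ext) (simp add: reindex_def)

lemma reindex_add: "reindex h g (mat_add a b) = mat_add (reindex h g a) (reindex h g b)"
  by (intro ext) (simp add: reindex_def mat_add_def)

lemma mat_star_reindex: "mat_star (reindex h g a) = reindex g h (mat_star a)"
  by (intro ext) (simp add: reindex_def mat_star_def)

lemma reindex_reindex:
  assumes "inj h" "inj g" "inj h'" "inj g'"
  shows "reindex h g (reindex h' g' a) = reindex (h \<circ> h') (g \<circ> g') a"
proof (intro ext)
  fix i j
  have inv: "inv_into UNIV (h \<circ> h') (h (h' k)) = k" "inv_into UNIV (g \<circ> g') (g (g' k)) = k" for k
    using assms inv_f_f[of "h \<circ> h'"] inv_f_f[of "g \<circ> g'"] by (auto simp: inj_compose)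
  show "reindex h g (reindex h' g' a) i j = reindex (h \<circ> h') (g \<circ> g') a i j"
    using assms by (auto simp: reindex_def image_comp[symmetric] inv)
qed

lemma mat_mult_reindex:
  assumes "a \<in> M_inf UNIV" "inj h" "inj g" "inj k"
  shows "mat_mult (reindex h g a) (reindex g k b) = reindex h k (mat_mult a b)"
proof (intro ext)
  fix i j
  obtain N where N: "\<And>i j. a i j \<noteq> 0 \<Longrightarrow> i < N \<and> j < N" using M_inf_bound[OF assms(1)] by blast
  have "mat_mult (reindex h g a) (reindex g k b) i j
      = (\<Sum>l\<in>g ` {..<N}. reindex h g a i l * reindex g k b l j)"
    using assms N
    by (intro mat_mult_eq_sum M_inf_finite_row[OF reindex_UNIV_closed])
      (auto simp: reindex_def split: if_splits)
  also have "\<dots> = (\<Sum>l<N. reindex h g a i (g l) * reindex g k b (g l) j)"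
    using assms by (simp add: sum.reindex inj_on_subset)
  also have "\<dots> = reindex h k (mat_mult a b) i j"
    using assms N by (auto simp: reindex_def mat_mult_eq_sum_lessThan[OF assms(1), of N])
  finally show "mat_mult (reindex h g a) (reindex g k b) i j = reindex h k (mat_mult a b) i j" .
qed

lemma mat_mult_reindex_disjoint:
  assumes "range g \<inter> range g' = {}"
  shows "mat_mult (reindex h g a) (reindex g' k b) = mat_zero"
proof (intro ext)
  fix i j
  have "reindex h g a i l * reindex g' k b l j = 0" for l
    using assms by (auto simp: reindex_def)
  then show "mat_mult (reindex h g a) (reindex g' k b) i j = mat_zero i j"
    by (simp add: mat_mult_def mat_zero_def)
qed

abbreviation dbl :: "nat \<Rightarrow> nat" where "dbl \<equiv> \<lambda>i. 2 * i"
abbreviation dbl1 :: "nat \<Rightarrow> nat" where "dbl1 \<equiv> \<lambda>i. Suc (2 * i)"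

lemma inj_dbl: "inj dbl" "inj dbl1"
  by (auto simp: inj_def)

lemma range_dbl: "i \<in> range dbl \<longleftrightarrow> even i" "i \<in> range dbl1 \<longleftrightarrow> odd i"
  by (auto elim!: evenE oddE) presburger

lemma inv_dbl: "even i \<Longrightarrow> inv_into UNIV dbl i = i div 2" "odd i \<Longrightarrow> inv_into UNIV dbl1 i = i div 2"
  using inv_f_f[OF inj_dbl(1), of "i div 2"] inv_f_f[OF inj_dbl(2), of "i div 2"] by auto

text \<open>The direct sum becomes an orthogonal sum of two reindexed copies. Commutativity and
  associativity up to equivalence then only concern the choice of injections.\<close>

lemma mat_oplus_eq_reindex:
  "mat_oplus a b = mat_add (reindex dbl dbl a) (reindex dbl1 dbl1 b)"
  by (intro ext) (auto simp: mat_oplus_def mat_add_def reindex_def range_dbl inv_dbl)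

lemma range_dbl_disjoint: "range dbl \<inter> range dbl1 = {}" "range dbl1 \<inter> range dbl = {}"
  using range_dbl by blast+

section \<open>Murray-von Neumann equivalence of matrix projections\<close>

text \<open>Covers both ends of the scalar map: \<open>unitization B\<close> and the complex
  numbers.\<close>

locale star_subring =
  fixes A :: "'a::cstar_algebra_1 set"
  assumes zero_closed: "0 \<in> A"
    and add_closed: "a \<in> A \<Longrightarrow> b \<in> A \<Longrightarrow> a + b \<in> A"
    and mult_closed: "a \<in> A \<Longrightarrow> b \<in> A \<Longrightarrow> a * b \<in> A"
    and star_closed: "a \<in> A \<Longrightarrow> star a \<in> A"
begin

lemma M_inf_iff: "a \<in> M_inf A \<longleftrightarrow> a \<in> M_inf UNIV \<and> (\<forall>i j. a i j \<in> A)"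
  by (auto simp: M_inf_def)

lemma sum_closed: "(\<And>k. k \<in> K \<Longrightarrow> f k \<in> A) \<Longrightarrow> sum f K \<in> A"
  by (induction K rule: infinite_finite_induct) (auto intro: zero_closed add_closed)

lemma mat_mult_closed: "a \<in> M_inf A \<Longrightarrow> b \<in> M_inf A \<Longrightarrow> mat_mult a b \<in> M_inf A"
  unfolding M_inf_iff
  by (auto intro!: mat_mult_UNIV_closed) (auto intro!: sum_closed mult_closed simp: mat_mult_def)

lemma mat_add_closed: "a \<in> M_inf A \<Longrightarrow> b \<in> M_inf A \<Longrightarrow> mat_add a b \<in> M_inf A"
  unfolding M_inf_iff
  by (auto intro!: mat_add_UNIV_closed) (auto intro!: add_closed simp: mat_add_def)

lemma mat_star_closed: "a \<in> M_inf A \<Longrightarrow> mat_star a \<in> M_inf A"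
  unfolding M_inf_iff
  by (auto intro!: mat_star_UNIV_closed) (auto intro!: star_closed simp: mat_star_def)

lemma reindex_closed: "a \<in> M_inf A \<Longrightarrow> inj h \<Longrightarrow> inj g \<Longrightarrow> reindex h g a \<in> M_inf A"
  unfolding M_inf_iff
  by (auto intro!: reindex_UNIV_closed) (auto intro!: zero_closed simp: reindex_def)

lemma mat_zero_Proj_inf: "mat_zero \<in> Proj_inf A"
  by (auto simp: Proj_inf_def M_inf_def mat_zero_def zero_closed mat_mult_def mat_star_def)

lemma mat_corner_M_inf: "a \<in> A \<Longrightarrow> mat_corner a \<in> M_inf A"
  by (auto simp: M_inf_def mat_corner_def zero_closed intro: finite_subset[of _ "{(0, 0)}"])

end

lemma mat_corner_zero [simp]: "mat_corner 0 = mat_zero"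
  by (intro ext) (simp add: mat_corner_def mat_zero_def)

lemma mat_mult_corner: "mat_mult (mat_corner a) (mat_corner b) = mat_corner (a * b)"
proof (intro ext)
  fix i j
  have "mat_mult (mat_corner a) (mat_corner b) i j
      = (\<Sum>k\<in>{0}. mat_corner a i k * mat_corner b k j)"
    by (intro mat_mult_eq_sum)
      (auto simp: mat_corner_def split: if_splits intro: finite_subset[of _ "{0}"])
  then show "mat_mult (mat_corner a) (mat_corner b) i j = mat_corner (a * b) i j"
    by (simp add: mat_corner_def)
qed

lemma mat_star_corner: "mat_star (mat_corner a) = mat_corner (star a)"
  by (intro ext) (auto simp: mat_corner_def mat_star_def)

lemma Proj_inf_UNIV: "p \<in> Proj_inf A \<Longrightarrow> p \<in> M_inf UNIV"
  by (auto simp: Proj_inf_def M_inf_def)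

lemma Proj_infD: "p \<in> Proj_inf A \<Longrightarrow> mat_mult p p = p" "p \<in> Proj_inf A \<Longrightarrow> mat_star p = p"
  "p \<in> Proj_inf A \<Longrightarrow> p \<in> M_inf A"
  by (auto simp: Proj_inf_def)

context star_subring
begin

lemma mat_corner_Proj_inf: "p \<in> A \<Longrightarrow> projection p \<Longrightarrow> mat_corner p \<in> Proj_inf A"
  by (simp add: Proj_inf_def mat_corner_M_inf mat_mult_corner mat_star_corner projection_def)

lemma mat_add_Proj_inf:
  assumes p: "p \<in> Proj_inf A" and q: "q \<in> Proj_inf A" and pq: "mat_mult p q = mat_zero"
  shows "mat_add p q \<in> Proj_inf A" "mat_mult q p = mat_zero"
proof -
  note [simp] = Proj_inf_UNIV[OF p] Proj_inf_UNIV[OF q] Proj_infD[OF p] Proj_infD[OF q]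
  have "mat_star (mat_mult p q) = mat_mult q p" by (simp add: mat_star_mult)
  then show qp: "mat_mult q p = mat_zero" using pq by simp
  show "mat_add p q \<in> Proj_inf A"
    using pq qp by (simp add: Proj_inf_def mat_add_closed mat_star_add
        mat_mult_add_right mat_mult_add_left mat_add_UNIV_closed)
qed

text \<open>
  In a C*-algebra \<open>v * p = v\<close> is automatic, but for matrices this would need positivity of sums
  \<open>\<Sum>k. star (v k j) * v k j\<close>. Replacing \<open>v\<close> by \<open>v * p\<close> avoids it.
\<close>

lemma mvn_normalize:
  assumes "mvn_equiv_inf A p q" "p \<in> Proj_inf A" "q \<in> Proj_inf A"
  obtains v where "v \<in> M_inf A" "mat_mult (mat_star v) v = p" "mat_mult v (mat_star v) = q"
    "mat_mult v p = v" "mat_mult q v = v"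
proof -
  obtain v where v: "v \<in> M_inf A" "mat_mult (mat_star v) v = p" "mat_mult v (mat_star v) = q"
    using assms(1) by (auto simp: mvn_equiv_inf_def)
  note [simp] = v(1)[THEN M_inf_UNIV] Proj_inf_UNIV[OF assms(2)] Proj_inf_UNIV[OF assms(3)]
    mat_star_UNIV_closed mat_mult_UNIV_closed mat_star_mult
  have p: "mat_mult p p = p" "mat_star p = p" using assms(2) by (auto simp: Proj_inf_def)
  have q: "mat_mult q q = q" using assms(3) by (auto simp: Proj_inf_def)
  define w where "w = mat_mult v p"
  have w: "w \<in> M_inf A" using v assms(2) by (auto simp: w_def Proj_inf_def intro: mat_mult_closed)
  have 1: "mat_mult (mat_star w) w = mat_mult p (mat_mult (mat_mult (mat_star v) v) p)"
    by (simp add: w_def p mat_mult_assoc)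
  have "mat_mult w (mat_star w) = mat_mult v (mat_mult (mat_mult p p) (mat_star v))"
    by (simp add: w_def p(2) mat_mult_assoc)
  also have "\<dots> = mat_mult v (mat_mult p (mat_star v))" by (simp only: p(1))
  also have "\<dots> = mat_mult (mat_mult v (mat_star v)) (mat_mult v (mat_star v))"
    unfolding v(2)[symmetric] by (simp add: mat_mult_assoc)
  finally have 2: "mat_mult w (mat_star w) = q" by (simp add: v q)
  have 3: "mat_mult w p = w" by (simp add: w_def mat_mult_assoc p)
  have "mat_mult q w = mat_mult v (mat_mult (mat_mult (mat_star v) v) p)"
    unfolding v(3)[symmetric] by (simp add: w_def mat_mult_assoc)
  then have 4: "mat_mult q w = w" by (simp add: v p w_def)
  show ?thesis using that[OF w] 1 2 3 4 by (simp add: v p)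
qed

lemma mvn_refl: "p \<in> Proj_inf A \<Longrightarrow> mvn_equiv_inf A p p"
  unfolding mvn_equiv_inf_def by (rule bexI[of _ p]) (auto simp: Proj_inf_def)

lemma mvn_sym: "mvn_equiv_inf A p q \<Longrightarrow> mvn_equiv_inf A q p"
  unfolding mvn_equiv_inf_def by (metis mat_star_closed mat_star_star)

lemma mvn_trans:
  assumes "mvn_equiv_inf A p q" "mvn_equiv_inf A q r"
    and p: "p \<in> Proj_inf A" and q: "q \<in> Proj_inf A" and r: "r \<in> Proj_inf A"
  shows "mvn_equiv_inf A p r"
proof -
  obtain v where v: "v \<in> M_inf A" "mat_mult (mat_star v) v = p" "mat_mult v (mat_star v) = q"
    "mat_mult v p = v" "mat_mult q v = v" using mvn_normalize[OF assms(1) p q] by blast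
  obtain w where w: "w \<in> M_inf A" "mat_mult (mat_star w) w = q" "mat_mult w (mat_star w) = r"
    "mat_mult w q = w" "mat_mult r w = w" using mvn_normalize[OF assms(2) q r] by blast
  note [simp] = v(1)[THEN M_inf_UNIV] w(1)[THEN M_inf_UNIV]
    mat_star_UNIV_closed mat_mult_UNIV_closed
  have "mat_mult (mat_star (mat_mult w v)) (mat_mult w v)
      = mat_mult (mat_star v) (mat_mult (mat_mult (mat_star w) w) v)"
    by (simp add: mat_mult_assoc mat_star_mult)
  moreover have "mat_mult (mat_mult w v) (mat_star (mat_mult w v))
      = mat_mult w (mat_mult (mat_mult v (mat_star v)) (mat_star w))"
    by (simp add: mat_mult_assoc mat_star_mult)
  moreover have "mat_mult q (mat_star w) = mat_star w"
    using arg_cong[OF w(4), of mat_star] Proj_infD[OF q] Proj_inf_UNIV[OF q]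
    by (simp add: mat_star_mult)
  ultimately show ?thesis
    unfolding mvn_equiv_inf_def using v w
    by (intro bexI[of _ "mat_mult w v"]) (auto intro: mat_mult_closed)
qed

text \<open>After normalization \<open>v = p' v = v p\<close> and \<open>w = q' w = w q\<close>, so
  orthogonality of the initial and of the final projections removes all cross terms from the
  products of \<open>v + w\<close> with its adjoint.\<close>

lemma mvn_add:
  assumes pp': "mvn_equiv_inf A p p'" and qq': "mvn_equiv_inf A q q'"
    and p: "p \<in> Proj_inf A" "p' \<in> Proj_inf A" and q: "q \<in> Proj_inf A" "q' \<in> Proj_inf A"
    and perp: "mat_mult p q = mat_zero" "mat_mult p' q' = mat_zero"
  shows "mvn_equiv_inf A (mat_add p q) (mat_add p' q')"
proof -
  obtain v where v: "v \<in> M_inf A" "mat_mult (mat_star v) v = p" "mat_mult v (mat_star v) = p'"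
    "mat_mult v p = v" "mat_mult p' v = v" using mvn_normalize[OF pp' p] by blast
  obtain w where w: "w \<in> M_inf A" "mat_mult (mat_star w) w = q" "mat_mult w (mat_star w) = q'"
    "mat_mult w q = w" "mat_mult q' w = w" using mvn_normalize[OF qq' q] by blast
  note UN [simp] = v(1)[THEN M_inf_UNIV] w(1)[THEN M_inf_UNIV]
    mat_star_UNIV_closed mat_mult_UNIV_closed p[THEN Proj_inf_UNIV] q[THEN Proj_inf_UNIV]
    Proj_infD(2)[OF p(1)] Proj_infD(2)[OF p(2)] Proj_infD(2)[OF q(1)] Proj_infD(2)[OF q(2)]
  have "mat_mult (mat_star (mat_mult p' v)) (mat_mult q' w)
      = mat_mult (mat_star v) (mat_mult (mat_mult p' q') w)"
    by (simp add: mat_star_mult mat_mult_assoc)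
  then have vw: "mat_mult (mat_star v) w = mat_zero" by (simp add: v w perp)
  have "mat_mult (mat_mult v p) (mat_star (mat_mult w q))
      = mat_mult v (mat_mult (mat_mult p q) (mat_star w))"
    by (simp add: mat_star_mult mat_mult_assoc)
  then have vw': "mat_mult v (mat_star w) = mat_zero" by (simp add: v w perp)
  have wv: "mat_mult (mat_star w) v = mat_zero"
    using arg_cong[OF vw, of mat_star] by (simp add: mat_star_mult)
  have wv': "mat_mult w (mat_star v) = mat_zero"
    using arg_cong[OF vw', of mat_star] by (simp add: mat_star_mult)
  have "mat_mult (mat_star (mat_add v w)) (mat_add v w) = mat_add p q"
    by (simp add: mat_star_add mat_mult_add_left mat_mult_add_right vw wv v w)
  moreover have "mat_mult (mat_add v w) (mat_star (mat_add v w)) = mat_add p' q'"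
    by (simp add: mat_star_add mat_mult_add_left mat_mult_add_right vw' wv' v w)
  ultimately show ?thesis
    unfolding mvn_equiv_inf_def using v(1) w(1)
    by (intro bexI[of _ "mat_add v w"]) (auto intro: mat_add_closed)
qed

lemma reindex_Proj_inf:
  assumes "p \<in> Proj_inf A" "inj h"
  shows "reindex h h p \<in> Proj_inf A"
  using assms Proj_inf_UNIV[OF assms(1)]
  by (simp add: Proj_inf_def reindex_closed mat_mult_reindex mat_star_reindex)

lemma mvn_reindex:
  assumes p: "p \<in> Proj_inf A" and h: "inj h"
  shows "mvn_equiv_inf A p (reindex h h p)"
  unfolding mvn_equiv_inf_def
\<comment> \<open>The isometry that carries coordinate \<open>k\<close> to \<open>h k\<close>, cut
  down by \<open>p\<close> to have finite support.\<close>
proof (rule bexI[of _ "reindex h id p"])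
  note [simp] = Proj_inf_UNIV[OF p] Proj_infD[OF p]
  show "mat_mult (mat_star (reindex h id p)) (reindex h id p) = p
      \<and> mat_mult (reindex h id p) (mat_star (reindex h id p)) = reindex h h p"
    using h by (simp add: mat_star_reindex mat_mult_reindex)
  show "reindex h id p \<in> M_inf A" using h by (simp add: reindex_closed)
qed

lemma mvn_reindex_reindex:
  assumes "p \<in> Proj_inf A" "p' \<in> Proj_inf A" "mvn_equiv_inf A p p'" "inj h" "inj g"
  shows "mvn_equiv_inf A (reindex h h p) (reindex g g p')"
  by (meson assms mvn_reindex mvn_sym mvn_trans reindex_Proj_inf)

lemma mat_oplus_Proj_inf: "p \<in> Proj_inf A \<Longrightarrow> q \<in> Proj_inf A \<Longrightarrow> mat_oplus p q \<in> Proj_inf A"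
  unfolding mat_oplus_eq_reindex
  by (intro mat_add_Proj_inf(1) reindex_Proj_inf inj_dbl mat_mult_reindex_disjoint range_dbl_disjoint)

lemma mvn_oplus:
  assumes "p \<in> Proj_inf A" "p' \<in> Proj_inf A" "q \<in> Proj_inf A" "q' \<in> Proj_inf A"
    and "mvn_equiv_inf A p p'" "mvn_equiv_inf A q q'"
  shows "mvn_equiv_inf A (mat_oplus p q) (mat_oplus p' q')"
  unfolding mat_oplus_eq_reindex using assms
  by (intro mvn_add mvn_reindex_reindex reindex_Proj_inf inj_dbl mat_mult_reindex_disjoint
      range_dbl_disjoint)

lemma mvn_oplus_commute:
  assumes "p \<in> Proj_inf A" "q \<in> Proj_inf A"
  shows "mvn_equiv_inf A (mat_oplus p q) (mat_oplus q p)"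
  unfolding mat_oplus_eq_reindex mat_add_commute[of "reindex dbl dbl q"] using assms
  by (intro mvn_add mvn_reindex_reindex reindex_Proj_inf inj_dbl mat_mult_reindex_disjoint
      range_dbl_disjoint mvn_refl)

text \<open>Both sides are sums of copies of \<open>p\<close>, \<open>q\<close> and \<open>r\<close>
  along three injections with disjoint ranges, and \<open>mvn_add\<close>, used twice, compares them
  copy by copy.\<close>

lemma mvn_oplus_assoc:
  assumes p: "p \<in> Proj_inf A" and q: "q \<in> Proj_inf A" and r: "r \<in> Proj_inf A"
  shows "mvn_equiv_inf A (mat_oplus (mat_oplus p q) r) (mat_oplus p (mat_oplus q r))"
proof -
  note inj = inj_dbl inj_compose[OF inj_dbl(1) inj_dbl(1)] inj_compose[OF inj_dbl(1) inj_dbl(2)]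
    inj_compose[OF inj_dbl(2) inj_dbl(1)] inj_compose[OF inj_dbl(2) inj_dbl(2)]
  have l: "mat_oplus (mat_oplus p q) r = mat_add (mat_add (reindex (dbl \<circ> dbl) (dbl \<circ> dbl) p)
      (reindex (dbl \<circ> dbl1) (dbl \<circ> dbl1) q)) (reindex dbl1 dbl1 r)"
    by (simp add: mat_oplus_eq_reindex reindex_add reindex_reindex inj_dbl)
  have r': "mat_oplus p (mat_oplus q r) = mat_add (mat_add (reindex dbl dbl p)
      (reindex (dbl1 \<circ> dbl) (dbl1 \<circ> dbl) q)) (reindex (dbl1 \<circ> dbl1) (dbl1 \<circ> dbl1) r)"
    by (simp add: mat_oplus_eq_reindex reindex_add reindex_reindex inj_dbl mat_add_assoc)
  have d: "range (dbl \<circ> dbl) \<inter> range (dbl \<circ> dbl1) = {}" "range (dbl \<circ> dbl) \<inter> range dbl1 = {}"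
    "range (dbl \<circ> dbl1) \<inter> range dbl1 = {}" "range dbl \<inter> range (dbl1 \<circ> dbl) = {}"
    "range dbl \<inter> range (dbl1 \<circ> dbl1) = {}" "range (dbl1 \<circ> dbl) \<inter> range (dbl1 \<circ> dbl1) = {}"
    by (auto, presburger+)
  note perp = d[THEN mat_mult_reindex_disjoint]
  have UN: "reindex h h x \<in> M_inf UNIV" if "inj h" "x \<in> Proj_inf A" for h x
    using that by (simp add: reindex_UNIV_closed Proj_inf_UNIV)
  show ?thesis
    unfolding l r' using p q r
    by (intro mvn_add mvn_reindex_reindex reindex_Proj_inf inj perp mvn_refl mat_add_Proj_inf(1))
      (simp_all add: mat_mult_add_left UN inj perp)
qed

end

section \<open>The Grothendieck group\<close>

context star_subring
begin

text \<open>Membership is built in so that transitivity has no side conditions and equivalences can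
  be chained.\<close>

definition mvn_proj :: "(nat \<Rightarrow> nat \<Rightarrow> 'a) \<Rightarrow> (nat \<Rightarrow> nat \<Rightarrow> 'a) \<Rightarrow> bool"  (infix \<open>\<simeq>\<^sub>0\<close> 50)
  where "p \<simeq>\<^sub>0 q \<longleftrightarrow> p \<in> Proj_inf A \<and> q \<in> Proj_inf A \<and> mvn_equiv_inf A p q"

lemma mvn_proj_Proj_inf: "p \<simeq>\<^sub>0 q \<Longrightarrow> p \<in> Proj_inf A" "p \<simeq>\<^sub>0 q \<Longrightarrow> q \<in> Proj_inf A"
  by (auto simp: mvn_proj_def)

lemma mvn_proj_refl: "p \<in> Proj_inf A \<Longrightarrow> p \<simeq>\<^sub>0 p"
  by (simp add: mvn_proj_def mvn_refl)

lemma mvn_proj_sym: "p \<simeq>\<^sub>0 q \<Longrightarrow> q \<simeq>\<^sub>0 p"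
  by (auto simp: mvn_proj_def intro: mvn_sym)

lemma mvn_proj_trans [trans]: "p \<simeq>\<^sub>0 q \<Longrightarrow> q \<simeq>\<^sub>0 r \<Longrightarrow> p \<simeq>\<^sub>0 r"
  unfolding mvn_proj_def by (blast intro: mvn_trans)

lemma mvn_proj_oplus: "p \<simeq>\<^sub>0 p' \<Longrightarrow> q \<simeq>\<^sub>0 q' \<Longrightarrow> mat_oplus p q \<simeq>\<^sub>0 mat_oplus p' q'"
  by (auto simp: mvn_proj_def mat_oplus_Proj_inf intro: mvn_oplus)

lemma mvn_proj_commute:
  "p \<in> Proj_inf A \<Longrightarrow> q \<in> Proj_inf A \<Longrightarrow> mat_oplus p q \<simeq>\<^sub>0 mat_oplus q p"
  by (auto simp: mvn_proj_def mat_oplus_Proj_inf intro: mvn_oplus_commute)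

lemma mvn_proj_assoc:
  "p \<in> Proj_inf A \<Longrightarrow> q \<in> Proj_inf A \<Longrightarrow> r \<in> Proj_inf A \<Longrightarrow>
    mat_oplus (mat_oplus p q) r \<simeq>\<^sub>0 mat_oplus p (mat_oplus q r)"
  by (auto simp: mvn_proj_def mat_oplus_Proj_inf intro: mvn_oplus_assoc)

lemma mvn_proj_interchange:
  assumes a: "a \<in> Proj_inf A" and b: "b \<in> Proj_inf A" and c: "c \<in> Proj_inf A" and d: "d \<in> Proj_inf A"
  shows "mat_oplus (mat_oplus a b) (mat_oplus c d) \<simeq>\<^sub>0 mat_oplus (mat_oplus a c) (mat_oplus b d)"
proof -
  note P = assms mat_oplus_Proj_inf
  have "mat_oplus (mat_oplus a b) (mat_oplus c d) \<simeq>\<^sub>0 mat_oplus a (mat_oplus b (mat_oplus c d))"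
    by (intro mvn_proj_assoc P)
  also have "\<dots> \<simeq>\<^sub>0 mat_oplus a (mat_oplus (mat_oplus b c) d)"
    by (intro mvn_proj_oplus mvn_proj_refl mvn_proj_sym[OF mvn_proj_assoc] P)
  also have "\<dots> \<simeq>\<^sub>0 mat_oplus a (mat_oplus (mat_oplus c b) d)"
    by (intro mvn_proj_oplus mvn_proj_commute[OF b c] mvn_proj_refl a d)
  also have "\<dots> \<simeq>\<^sub>0 mat_oplus a (mat_oplus c (mat_oplus b d))"
    by (intro mvn_proj_oplus mvn_proj_refl mvn_proj_assoc P)
  also have "\<dots> \<simeq>\<^sub>0 mat_oplus (mat_oplus a c) (mat_oplus b d)"
    by (intro mvn_proj_sym[OF mvn_proj_assoc] P)
  finally show ?thesis .
qed

lemma K00_rel_iff: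
  "((p, q), (p', q')) \<in> K00_rel A \<longleftrightarrow>
    p \<in> Proj_inf A \<and> q \<in> Proj_inf A \<and> p' \<in> Proj_inf A \<and> q' \<in> Proj_inf A \<and>
    (\<exists>r\<in>Proj_inf A. mat_oplus (mat_oplus p q') r \<simeq>\<^sub>0 mat_oplus (mat_oplus p' q) r)"
  by (auto simp: K00_rel_def mvn_proj_def mat_oplus_Proj_inf)

lemma K00_rel_refl: "p \<in> Proj_inf A \<Longrightarrow> q \<in> Proj_inf A \<Longrightarrow> ((p, q), (p, q)) \<in> K00_rel A"
  unfolding K00_rel_iff
  by (auto intro!: bexI[of _ mat_zero] mvn_proj_refl mat_oplus_Proj_inf mat_zero_Proj_inf)

lemma K00_rel_sym: "(x, y) \<in> K00_rel A \<Longrightarrow> (y, x) \<in> K00_rel A"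
  by (cases x; cases y) (auto simp: K00_rel_iff intro: mvn_proj_sym)

lemma K00_rel_trans:
  assumes "((p, q), (p', q')) \<in> K00_rel A" "((p', q'), (p'', q'')) \<in> K00_rel A"
  shows "((p, q), (p'', q'')) \<in> K00_rel A"
proof -
  obtain r where r: "r \<in> Proj_inf A" "mat_oplus (mat_oplus p q') r \<simeq>\<^sub>0 mat_oplus (mat_oplus p' q) r"
    using assms(1) by (auto simp: K00_rel_iff)
  obtain r' where r': "r' \<in> Proj_inf A"
    "mat_oplus (mat_oplus p' q'') r' \<simeq>\<^sub>0 mat_oplus (mat_oplus p'' q') r'"
    using assms(2) by (auto simp: K00_rel_iff)
  have pq: "p \<in> Proj_inf A" "q \<in> Proj_inf A" "p' \<in> Proj_inf A" "q' \<in> Proj_inf A"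
    "p'' \<in> Proj_inf A" "q'' \<in> Proj_inf A"
    using assms by (auto simp: K00_rel_iff)
  note P = pq r(1) r'(1) mat_oplus_Proj_inf
  \<comment> \<open>The stabilizing summand: \<open>q'\<close> and \<open>r\<close> complete
    \<open>p\<close> to the left side of the first equivalence, \<open>p'\<close> and
    \<open>r'\<close> complete \<open>q''\<close> to the left side of the second.\<close>
  define R where "R = mat_oplus (mat_oplus q' r) (mat_oplus p' r')"
  have R: "R \<in> Proj_inf A" unfolding R_def by (intro P)
  have "mat_oplus (mat_oplus p q'') R
      \<simeq>\<^sub>0 mat_oplus (mat_oplus p (mat_oplus q' r)) (mat_oplus q'' (mat_oplus p' r'))"
    unfolding R_def by (intro mvn_proj_interchange P)
  also have "\<dots> \<simeq>\<^sub>0 mat_oplus (mat_oplus (mat_oplus p q') r) (mat_oplus (mat_oplus q'' p') r')"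
    by (intro mvn_proj_oplus mvn_proj_sym[OF mvn_proj_assoc] P)
  also have "\<dots> \<simeq>\<^sub>0 mat_oplus (mat_oplus (mat_oplus p q') r) (mat_oplus (mat_oplus p' q'') r')"
    by (intro mvn_proj_oplus[OF mvn_proj_refl] mvn_proj_oplus[OF mvn_proj_commute mvn_proj_refl] P)
  also have "\<dots> \<simeq>\<^sub>0 mat_oplus (mat_oplus (mat_oplus p' q) r) (mat_oplus (mat_oplus p'' q') r')"
    by (intro mvn_proj_oplus r r')
  also have "\<dots> \<simeq>\<^sub>0 mat_oplus (mat_oplus (mat_oplus q p') r) (mat_oplus (mat_oplus p'' q') r')"
    by (intro mvn_proj_oplus[OF _ mvn_proj_refl] mvn_proj_commute mvn_proj_refl P)
  also have "\<dots> \<simeq>\<^sub>0 mat_oplus (mat_oplus q (mat_oplus p' r)) (mat_oplus p'' (mat_oplus q' r'))"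
    by (intro mvn_proj_oplus mvn_proj_assoc P)
  also have "\<dots> \<simeq>\<^sub>0 mat_oplus (mat_oplus q p'') (mat_oplus (mat_oplus p' r) (mat_oplus q' r'))"
    by (intro mvn_proj_interchange P)
  also have "\<dots> \<simeq>\<^sub>0 mat_oplus (mat_oplus p'' q) R"
  proof (rule mvn_proj_oplus[OF mvn_proj_commute])
    have "mat_oplus (mat_oplus p' r) (mat_oplus q' r') \<simeq>\<^sub>0 mat_oplus (mat_oplus p' q') (mat_oplus r r')"
      by (intro mvn_proj_interchange P)
    also have "\<dots> \<simeq>\<^sub>0 mat_oplus (mat_oplus q' p') (mat_oplus r r')"
      by (intro mvn_proj_oplus[OF mvn_proj_commute mvn_proj_refl] P)
    also have "\<dots> \<simeq>\<^sub>0 R" unfolding R_def by (intro mvn_proj_interchange P)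
    finally show "mat_oplus (mat_oplus p' r) (mat_oplus q' r') \<simeq>\<^sub>0 R" .
  qed (use pq in auto)
  finally show ?thesis using pq R by (auto simp: K00_rel_iff)
qed

lemma equiv_K00_rel: "equiv (Proj_inf A \<times> Proj_inf A) (K00_rel A)"
proof (rule equivI)
  show "K00_rel A \<subseteq> (Proj_inf A \<times> Proj_inf A) \<times> (Proj_inf A \<times> Proj_inf A)"
    by (auto simp: K00_rel_def)
  show "refl_on (Proj_inf A \<times> Proj_inf A) (K00_rel A)"
    by (auto simp: refl_on_def intro: K00_rel_refl)
  show "sym (K00_rel A)" by (rule symI) (rule K00_rel_sym)
  show "trans (K00_rel A)"
  proof (rule transI)
    fix x y z assume "(x, y) \<in> K00_rel A" "(y, z) \<in> K00_rel A"
    then show "(x, z) \<in> K00_rel A"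
      using K00_rel_trans by (cases x; cases y; cases z) blast
  qed
qed

lemma K00_class_mvn:
  assumes "p \<simeq>\<^sub>0 p'" "q \<in> Proj_inf A"
  shows "K00_class A p q = K00_class A p' q"
proof -
  have "((p, q), (p', q)) \<in> K00_rel A"
    using assms unfolding K00_rel_iff
    by (auto intro!: bexI[of _ mat_zero] mvn_proj_oplus mvn_proj_refl mat_zero_Proj_inf
        dest: mvn_proj_Proj_inf)
  then show ?thesis
    unfolding K00_class_def by (rule equiv_class_eq[OF equiv_K00_rel])
qed

lemma mvn_proj_corner:
  assumes "v \<in> A" "projection (star v * v)" "projection (v * star v)"
  shows "mat_corner (star v * v) \<simeq>\<^sub>0 mat_corner (v * star v)"
  unfolding mvn_proj_def mvn_equiv_inf_def using assms
  by (auto intro!: mat_corner_Proj_inf mult_closed star_closed bexI[of _ "mat_corner v"]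
      mat_corner_M_inf simp: mat_mult_corner mat_star_corner)

end

section \<open>Unitization, scalar parts and the group K0 of a proper ideal\<close>

interpretation complex_UNIV: star_subring "UNIV :: complex set"
  by unfold_locales auto

text \<open>Since the unit is outside \<open>B\<close>, an element \<open>b + z *\<^sub>C 1\<close>
  with \<open>b \<in> B\<close> determines \<open>z\<close>; this makes \<open>scalar_part\<close>
  meaningful.\<close>

locale proper_ideal =
  fixes B :: "'a::cstar_algebra_1 set"
  assumes closed_ideal: "closed_ideal UNIV B" and one_notin: "1 \<notin> B"
begin

lemma ideal_closed:
  "0 \<in> B" "a \<in> B \<Longrightarrow> b \<in> B \<Longrightarrow> a + b \<in> B" "a \<in> B \<Longrightarrow> z *\<^sub>C a \<in> B"
  "b \<in> B \<Longrightarrow> a * b \<in> B" "b \<in> B \<Longrightarrow> b * a \<in> B"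
  using closed_ideal by (auto simp: closed_ideal_def)

lemma minus_closed: "a \<in> B \<Longrightarrow> - a \<in> B"
  using ideal_closed(3)[of a "-1"] by (simp add: scaleC_minus_left)

lemma diff_closed: "a \<in> B \<Longrightarrow> b \<in> B \<Longrightarrow> a - b \<in> B"
  using ideal_closed(2)[of a "- b"] minus_closed by simp

lemma star_in_ideal: "a \<in> B \<Longrightarrow> star a \<in> B"
  by (rule closed_ideal_star[OF closed_ideal])

lemma ideal_subset_unitization: "B \<subseteq> unitization B"
proof
  fix b assume "b \<in> B"
  then have "b + 0 *\<^sub>C 1 \<in> unitization B" unfolding unitization_def by blast
  then show "b \<in> unitization B" by simp
qed

lemma unitizationE:
  assumes "a \<in> unitization B"
  obtains b z where "a = b + z *\<^sub>C 1" "b \<in> B"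
  using assms by (auto simp: unitization_def)

lemma unitizationI: "b \<in> B \<Longrightarrow> b + z *\<^sub>C 1 \<in> unitization B"
  by (auto simp: unitization_def)

lemma scalar_part_eq:
  assumes "b \<in> B"
  shows "scalar_part B (b + z *\<^sub>C 1) = z"
  unfolding scalar_part_def
proof (rule the_equality)
  show "b + z *\<^sub>C 1 - z *\<^sub>C 1 \<in> B" using assms by simp
  fix y assume "b + z *\<^sub>C 1 - y *\<^sub>C 1 \<in> B"
  then have "b + z *\<^sub>C 1 - y *\<^sub>C 1 - b \<in> B" using assms by (rule diff_closed)
  then have *: "(z - y) *\<^sub>C 1 \<in> B" by (simp add: scaleC_diff_left)
  show "y = z"
  proof (rule ccontr)
    assume "y \<noteq> z"
    then have "inverse (z - y) *\<^sub>C (z - y) *\<^sub>C 1 = (1::'a)"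
      by (simp add: scaleC_scaleC)
    then show False using ideal_closed(3)[OF *, of "inverse (z - y)"] one_notin by simp
  qed
qed

lemma scalar_part_ideal: "b \<in> B \<Longrightarrow> scalar_part B b = 0"
  using scalar_part_eq[of b 0] by simp

lemma unitization_mult:
  "(b + z *\<^sub>C 1) * (c + y *\<^sub>C 1) = (b * c + y *\<^sub>C b + z *\<^sub>C c) + (z * y) *\<^sub>C (1::'a)"
  by (simp add: distrib_left distrib_right scaleC_mult_left scaleC_mult_right scaleC_scaleC
      scaleC_add_right add.assoc mult.commute)

sublocale unitization: star_subring "unitization B"
proof
  show "0 \<in> unitization B" using ideal_subset_unitization ideal_closed(1) by blast
next
  fix a c assume "a \<in> unitization B" "c \<in> unitization B"
  then obtain b z d y where e: "a = b + z *\<^sub>C 1" "b \<in> B" "c = d + y *\<^sub>C 1" "d \<in> B"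
    by (metis unitizationE)
  have "a + c = (b + d) + (z + y) *\<^sub>C 1" by (simp add: e scaleC_add_left)
  then show "a + c \<in> unitization B" using e(2,4) by (simp only: unitizationI ideal_closed)
  have "a * c = (b * d + y *\<^sub>C b + z *\<^sub>C d) + (z * y) *\<^sub>C 1" by (simp add: e unitization_mult)
  then show "a * c \<in> unitization B" using e(2,4) by (simp only: unitizationI ideal_closed)
next
  fix a assume "a \<in> unitization B"
  then obtain b z where e: "a = b + z *\<^sub>C 1" "b \<in> B" by (metis unitizationE)
  then show "star a \<in> unitization B"
    by (simp add: star_add star_scaleC unitizationI star_in_ideal)
qed

lemma scalar_part_hom:
  assumes "a \<in> unitization B" "c \<in> unitization B"
  shows "scalar_part B (a + c) = scalar_part B a + scalar_part B c"
    and "scalar_part B (a * c) = scalar_part B a * scalar_part B c"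
    and "scalar_part B (star a) = star (scalar_part B a)"
proof -
  obtain b z d y where e: "a = b + z *\<^sub>C 1" "b \<in> B" "c = d + y *\<^sub>C 1" "d \<in> B"
    using assms by (metis unitizationE)
  have s: "scalar_part B a = z" "scalar_part B c = y" using e by (simp_all add: scalar_part_eq)
  have "a + c = (b + d) + (z + y) *\<^sub>C 1" by (simp add: e scaleC_add_left)
  then show "scalar_part B (a + c) = scalar_part B a + scalar_part B c"
    unfolding s using e by (simp only: scalar_part_eq ideal_closed)
  have "a * c = (b * d + y *\<^sub>C b + z *\<^sub>C d) + (z * y) *\<^sub>C 1" by (simp add: e unitization_mult)
  then show "scalar_part B (a * c) = scalar_part B a * scalar_part B c"
    unfolding s using e by (simp only: scalar_part_eq ideal_closed)
  have "star a = star b + cnj z *\<^sub>C 1" by (simp add: e star_add star_scaleC)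
  then show "scalar_part B (star a) = star (scalar_part B a)"
    unfolding s using e by (simp add: scalar_part_eq star_in_ideal star_complex_def)
qed

definition scalar_mat :: "(nat \<Rightarrow> nat \<Rightarrow> 'a) \<Rightarrow> nat \<Rightarrow> nat \<Rightarrow> complex" where
  "scalar_mat a = (\<lambda>i j. scalar_part B (a i j))"

lemma scalar_mat_M_inf: "a \<in> M_inf (unitization B) \<Longrightarrow> scalar_mat a \<in> M_inf UNIV"
  by (auto simp: M_inf_def scalar_mat_def scalar_part_ideal ideal_closed
      intro!: finite_subset[of "{(i, j). scalar_part B (a i j) \<noteq> 0}" "{(i, j). a i j \<noteq> 0}"])

lemma scalar_mat_mult:
  assumes a: "a \<in> M_inf (unitization B)" and b: "b \<in> M_inf (unitization B)"
  shows "scalar_mat (mat_mult a b) = mat_mult (scalar_mat a) (scalar_mat b)"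
proof (intro ext)
  fix i j
  obtain N where N: "\<And>i j. a i j \<noteq> 0 \<Longrightarrow> i < N \<and> j < N" using M_inf_bound[OF a] by blast
  have AB: "a i k * b k j \<in> unitization B" "a i k \<in> unitization B" "b k j \<in> unitization B" for k
    using a b by (auto simp: M_inf_def intro: unitization.mult_closed)
  have "scalar_part B (\<Sum>k<n. a i k * b k j) = (\<Sum>k<n. scalar_part B (a i k) * scalar_part B (b k j))"
    for n
    by (induction n) (auto simp: scalar_part_hom unitization.sum_closed AB scalar_part_ideal ideal_closed)
  moreover have "mat_mult a b i j = (\<Sum>k<N. a i k * b k j)"
    using N by (intro mat_mult_eq_sum_lessThan[OF a]) auto
  moreover have "mat_mult (scalar_mat a) (scalar_mat b) i j
      = (\<Sum>k<N. scalar_part B (a i k) * scalar_part B (b k j))"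
    unfolding scalar_mat_def
  proof (rule mat_mult_eq_sum_lessThan[OF scalar_mat_M_inf[OF a, unfolded scalar_mat_def]])
    show "j < N" if "scalar_part B (a i j) \<noteq> 0" for i j
      using that N[of i j] scalar_part_ideal[OF ideal_closed(1)] by metis
  qed
  ultimately show "scalar_mat (mat_mult a b) i j = mat_mult (scalar_mat a) (scalar_mat b) i j"
    by (simp add: scalar_mat_def)
qed

lemma scalar_mat_star:
  "a \<in> M_inf (unitization B) \<Longrightarrow> scalar_mat (mat_star a) = mat_star (scalar_mat a)"
  by (intro ext) (auto simp: scalar_mat_def mat_star_def M_inf_def intro!: scalar_part_hom(3))

lemma scalar_mat_oplus: "scalar_mat (mat_oplus a b) = mat_oplus (scalar_mat a) (scalar_mat b)"
  by (intro ext) (simp add: scalar_mat_def mat_oplus_def scalar_part_ideal ideal_closed)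

lemma scalar_mat_Proj_inf: "p \<in> Proj_inf (unitization B) \<Longrightarrow> scalar_mat p \<in> Proj_inf UNIV"
  by (simp add: Proj_inf_def scalar_mat_M_inf flip: scalar_mat_mult scalar_mat_star)

lemma scalar_mat_mvn:
  assumes "mvn_equiv_inf (unitization B) p q"
  shows "mvn_equiv_inf UNIV (scalar_mat p) (scalar_mat q)"
proof -
  obtain v where v: "v \<in> M_inf (unitization B)" "mat_mult (mat_star v) v = p" "mat_mult v (mat_star v) = q"
    using assms by (auto simp: mvn_equiv_inf_def)
  then show ?thesis
    unfolding mvn_equiv_inf_def
    by (intro bexI[of _ "scalar_mat v"])
      (auto simp: scalar_mat_M_inf unitization.mat_star_closed simp flip: scalar_mat_mult scalar_mat_star)
qed

text \<open>\<open>K00_scalar_map\<close> is a union over all representatives of a class; this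
  invariance collapses the union to a single class.\<close>

lemma scalar_mat_K00_rel:
  assumes "((p, q), (p', q')) \<in> K00_rel (unitization B)"
  shows "((scalar_mat p, scalar_mat q), (scalar_mat p', scalar_mat q')) \<in> K00_rel UNIV"
proof -
  obtain r where P: "p \<in> Proj_inf (unitization B)" "q \<in> Proj_inf (unitization B)"
    "p' \<in> Proj_inf (unitization B)" "q' \<in> Proj_inf (unitization B)" "r \<in> Proj_inf (unitization B)"
    and "mvn_equiv_inf (unitization B) (mat_oplus (mat_oplus p q') r) (mat_oplus (mat_oplus p' q) r)"
    using assms by (auto simp: K00_rel_def)
  then have "mvn_equiv_inf UNIV
      (mat_oplus (mat_oplus (scalar_mat p) (scalar_mat q')) (scalar_mat r))
      (mat_oplus (mat_oplus (scalar_mat p') (scalar_mat q)) (scalar_mat r))"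
    by (simp flip: scalar_mat_oplus add: scalar_mat_mvn)
  then show ?thesis using P by (auto simp: K00_rel_def scalar_mat_Proj_inf)
qed

text \<open>Group laws in \<open>K0 B\<close> apply to carrier elements only, so the class must be
  placed in the kernel of the scalar map. It lies there because every entry of the corner matrix of
  \<open>r\<close> is in \<open>B\<close> and has scalar part 0.\<close>

lemma K0_class_carrier:
  assumes r: "r \<in> B" "projection r"
  shows "K0_class B r \<in> carrier (K0 B)"
proof -
  let ?A = "unitization B"
  have P: "mat_corner r \<in> Proj_inf ?A" "mat_zero \<in> Proj_inf ?A"
    using r ideal_subset_unitization
    by (auto intro: unitization.mat_corner_Proj_inf unitization.mat_zero_Proj_inf)
  have z: "scalar_mat (mat_corner r) = mat_zero" "scalar_mat mat_zero = mat_zero"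
    using r by (auto simp: scalar_mat_def mat_corner_def mat_zero_def scalar_part_ideal
        ideal_closed fun_eq_iff)
  have cls: "K00_class UNIV (scalar_mat p) (scalar_mat q) = K00_class UNIV mat_zero mat_zero"
    if "(p, q) \<in> K00_class ?A (mat_corner r) mat_zero" for p q
  proof -
    have "((mat_corner r, mat_zero), (p, q)) \<in> K00_rel ?A"
      using that by (simp add: K00_class_def)
    from equiv_class_eq[OF complex_UNIV.equiv_K00_rel scalar_mat_K00_rel[OF this]]
    show ?thesis by (simp add: K00_class_def z)
  qed
  have self: "(mat_corner r, mat_zero) \<in> K00_class ?A (mat_corner r) mat_zero"
    using P by (simp add: K00_class_def unitization.K00_rel_refl)
  have "K00_scalar_map B (K0_class B r) = K00_class UNIV mat_zero mat_zero"
    unfolding K00_scalar_map_def K0_class_def scalar_mat_def[symmetric]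
    using cls self by (auto 0 3)
  moreover have "K0_class B r \<in> carrier (K00 ?A)"
    using P by (simp add: K00_def K0_class_def K00_class_def quotientI)
  ultimately show ?thesis by (simp add: K0_def kernel_def K00_def)
qed

lemma K0_class_eqI:
  assumes "v \<in> B" "projection (star v * v)" "projection (v * star v)"
  shows "K0_class B (star v * v) = K0_class B (v * star v)"
  unfolding K0_class_def using assms ideal_subset_unitization
  by (intro unitization.K00_class_mvn unitization.mvn_proj_corner unitization.mat_zero_Proj_inf) auto

lemma K0_class_zero: "K0_class B 0 = one (K0 B)"
  by (simp add: K0_class_def K0_def K00_def)

lemma K0_class_close:
  assumes "p \<in> B" "projection p" "projection q" "norm (p - q) \<le> 1 / 2"
  shows "K0_class B p = K0_class B q"
proof -
  obtain z where z: "star (q * p * z) * (q * p * z) = p" "q * p * z * star (q * p * z) = q"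
    using close_projections_equivalent assms by metis
  have "q * p * z \<in> B" using assms by (simp add: ideal_closed)
  from K0_class_eqI[OF this] show ?thesis using z assms by simp
qed

text \<open>Nearby values have the same class, so the class is locally constant and hence constant
  on the connected set \<open>S\<close>. The point \<open>s \<in> S\<close> excludes the empty set,
  where the definite description in \<open>K0_class_on\<close> would not single out a value.\<close>

lemma K0_class_on_eq:
  assumes S: "connected S" "s \<in> (S::real set)" and r: "continuous_on S r"
    "\<And>x. x \<in> S \<Longrightarrow> r x \<in> B" "\<And>x. x \<in> S \<Longrightarrow> projection (r x)"
  shows "K0_class_on B S r = K0_class B (r s)"
proof -
  have "\<forall>a\<in>S. eventually (\<lambda>b. K0_class B (r a) = K0_class B (r b)) (at a within S)"
  proof
    fix a assume a: "a \<in> S"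
    have "(r \<longlongrightarrow> r a) (at a within S)" using r(1) a by (simp add: continuous_on_def)
    then have "\<forall>\<^sub>F b in at a within S. dist (r b) (r a) < 1 / 2" by (rule tendstoD) simp
    moreover have "\<forall>\<^sub>F b in at a within S. b \<in> S" by (simp add: eventually_at_filter)
    ultimately show "\<forall>\<^sub>F b in at a within S. K0_class B (r a) = K0_class B (r b)"
    proof eventually_elim
      case (elim b)
      then show ?case using a r by (intro K0_class_close) (auto simp: dist_norm norm_minus_commute)
    qed
  qed
  then have "K0_class B (r x) = K0_class B (r s)" if "x \<in> S" for x
    using connected_local_const[OF S(1) that S(2), of "\<lambda>x. K0_class B (r x)"] by blast
  then show ?thesis
    unfolding K0_class_on_def using S(2) by (intro the_equality) (blast, metis)
qed

end

text \<open>If the unit were in \<open>B\<close>, some \<open>\<theta> a\<close> would be at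
  distance less than 1 from it, and \<open>\<theta> a * \<theta> c = 0\<close> would force
  \<open>\<theta> c = 0\<close>. But \<open>a\<close> has finite support and annihilates every
  matrix supported beyond it.\<close>

lemma one_notin_stable_ideal:
  assumes B: "closed_ideal UNIV B" "simple_cstar B" and st: "stable_cstar B"
  shows "1 \<notin> (B::'a::cstar_algebra_1 set)"
proof
  assume "1 \<in> B"
  obtain \<theta> :: "(nat \<Rightarrow> nat \<Rightarrow> 'a) \<Rightarrow> 'a" where inj: "inj_on \<theta> (M_inf B)"
    and dense: "B \<subseteq> closure (\<theta> ` M_inf B)"
    and add: "\<And>a b. a \<in> M_inf B \<Longrightarrow> b \<in> M_inf B \<Longrightarrow> \<theta> (mat_add a b) = \<theta> a + \<theta> b"
    and mult: "\<And>a b. a \<in> M_inf B \<Longrightarrow> b \<in> M_inf B \<Longrightarrow> \<theta> (mat_mult a b) = \<theta> a * \<theta> b"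
    using st unfolding stable_cstar_def by blast
  have "1 \<in> closure (\<theta> ` M_inf B)" using \<open>1 \<in> B\<close> dense by blast
  then obtain a where a: "a \<in> M_inf B" "dist (\<theta> a) 1 < 1"
    by (auto simp: closure_approachable dest: spec[of _ 1])
  have B0: "0 \<in> B" using B by (simp add: closed_ideal_def)
  obtain b where b: "b \<in> B" "b \<noteq> 0" using B(2) B0 by (auto simp: simple_cstar_def)
  obtain N where N: "\<And>i j. a i j \<noteq> 0 \<Longrightarrow> i < N \<and> j < N" using M_inf_bound[OF a(1)] by blast
  \<comment> \<open>The bound on the support of \<open>a\<close> is strict, so index
    \<open>N\<close> itself is already outside.\<close>
  define c where "c = (\<lambda>i j. if i = N \<and> j = N then b else 0)"
  have c: "c \<in> M_inf B" using b B0
    by (auto simp: c_def M_inf_def intro: finite_subset[of _ "{(N, N)}"])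
  have z: "mat_zero \<in> M_inf B" using B0 by (simp add: M_inf_def mat_zero_def)
  have z0: "\<theta> mat_zero = 0" using add[OF z z] by simp
  have "mat_mult a c = mat_zero"
  proof (intro ext)
    fix i j
    have "a i k * c k j = 0" for k
      using N[of i N] by (cases "a i N = 0") (auto simp: c_def)
    then show "mat_mult a c i j = mat_zero i j" by (simp add: mat_mult_def mat_zero_def)
  qed
  then have "\<theta> a * \<theta> c = 0" using mult[OF a(1) c] z0 by simp
  then have "\<theta> c = (1 - \<theta> a) * \<theta> c" by (simp add: algebra_simps)
  then have "norm (\<theta> c) \<le> dist (\<theta> a) 1 * norm (\<theta> c)"
    by (metis dist_norm dist_commute norm_mult_ineq)
  have "\<theta> c = 0"
  proof (rule ccontr)
    assume "\<theta> c \<noteq> 0"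
    then have "dist (\<theta> a) 1 * norm (\<theta> c) < 1 * norm (\<theta> c)"
      using a(2) by (intro mult_strict_right_mono) auto
    then show False using \<open>norm (\<theta> c) \<le> dist (\<theta> a) 1 * norm (\<theta> c)\<close> by simp
  qed
  then have "c = mat_zero" using inj c z z0 by (auto simp: inj_on_def)
  then have "c N N = 0" by (simp add: mat_zero_def)
  then show False using b by (simp add: c_def)
qed

section \<open>Cuntz pairs\<close>

lemma strict_continuous_on_compose:
  assumes "strict_continuous_on B S f" "continuous_on S' g" "g ` S' \<subseteq> S"
  shows "strict_continuous_on B S' (\<lambda>t. f (g t))"
  using assms unfolding strict_continuous_on_def by (auto intro: continuous_on_compose2)

lemma continuous_on_imp_strict: "continuous_on S f \<Longrightarrow> strict_continuous_on B S f"
  unfolding strict_continuous_on_def by (auto intro!: continuous_intros)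

lemma strict_continuous_on_joinpaths:
  assumes "strict_continuous_on B {0..1} f" "strict_continuous_on B {0..1} g" "f 1 = g 0"
  shows "strict_continuous_on B {0..1} (f +++ g)"
  unfolding strict_continuous_on_def
proof (intro ballI conjI)
  fix b assume b: "b \<in> B"
  have "continuous_on {0..1} ((\<lambda>x. f x * b) +++ (\<lambda>x. g x * b))"
    "continuous_on {0..1} ((\<lambda>x. b * f x) +++ (\<lambda>x. b * g x))"
    using assms b by (auto intro!: continuous_on_joinpaths
        simp: strict_continuous_on_def pathfinish_def pathstart_def)
  moreover have "((\<lambda>x. f x * b) +++ (\<lambda>x. g x * b)) = (\<lambda>x. (f +++ g) x * b)"
    "((\<lambda>x. b * f x) +++ (\<lambda>x. b * g x)) = (\<lambda>x. b * (f +++ g) x)"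
    by (auto simp: joinpaths_def fun_eq_iff)
  ultimately show "continuous_on {0..1} (\<lambda>x. (f +++ g) x * b)"
    "continuous_on {0..1} (\<lambda>x. b * (f +++ g) x)" by simp_all
qed

lemma Cuntz_homotopyI:
  assumes "\<And>t. t \<in> {0..1::real} \<Longrightarrow> (\<phi> t, \<psi> t) \<in> Cuntz_pairs B"
    and "\<And>z. strict_continuous_on B {0..1} (\<lambda>t. \<phi> t z)"
    and "\<And>z. strict_continuous_on B {0..1} (\<lambda>t. \<psi> t z)"
    and "\<And>z. continuous_on {0..1} (\<lambda>t. \<phi> t z - \<psi> t z)"
  shows "((\<phi> 0, \<psi> 0), (\<phi> 1, \<psi> 1)) \<in> Cuntz_homotopy B"
  unfolding Cuntz_homotopy_def using assms by blast

lemma Cuntz_homotopyE: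
  assumes "(c, d) \<in> Cuntz_homotopy B"
  obtains \<phi> \<psi> where "\<And>t. t \<in> {0..1::real} \<Longrightarrow> (\<phi> t, \<psi> t) \<in> Cuntz_pairs B"
    "c = (\<phi> 0, \<psi> 0)" "d = (\<phi> 1, \<psi> 1)"
    "\<And>z. strict_continuous_on B {0..1} (\<lambda>t. \<phi> t z)"
    "\<And>z. strict_continuous_on B {0..1} (\<lambda>t. \<psi> t z)"
    "\<And>z. continuous_on {0..1} (\<lambda>t. \<phi> t z - \<psi> t z)"
proof -
  obtain \<phi> \<psi> where "\<forall>t\<in>{0..1::real}. (\<phi> t, \<psi> t) \<in> Cuntz_pairs B"
    "c = (\<phi> 0, \<psi> 0)" "d = (\<phi> 1, \<psi> 1)"
    "\<forall>z. strict_continuous_on B {0..1} (\<lambda>t. \<phi> t z) \<and>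
      strict_continuous_on B {0..1} (\<lambda>t. \<psi> t z) \<and> continuous_on {0..1} (\<lambda>t. \<phi> t z - \<psi> t z)"
    using assms unfolding Cuntz_homotopy_def by blast
  then show ?thesis by (intro that[of \<phi> \<psi>]) blast+
qed

text \<open>Homotopies are reversed and concatenated. Norm continuity of the difference is carried
  along separately, as it does not follow from strict continuity of the two components.\<close>

lemma equiv_Cuntz_homotopy: "equiv (Cuntz_pairs B) (Cuntz_homotopy B)"
proof (rule equivI)
  show "Cuntz_homotopy B \<subseteq> Cuntz_pairs B \<times> Cuntz_pairs B"
    by (fastforce simp: Cuntz_homotopy_def)
  show "refl_on (Cuntz_pairs B) (Cuntz_homotopy B)"
  proof (rule refl_onI)
    fix c assume "c \<in> Cuntz_pairs B"
    then show "(c, c) \<in> Cuntz_homotopy B"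
      using Cuntz_homotopyI[of "\<lambda>_. fst c" "\<lambda>_. snd c" B] by (simp add: strict_continuous_on_def)
  qed
  show "sym (Cuntz_homotopy B)"
  proof (rule symI)
    fix c d assume "(c, d) \<in> Cuntz_homotopy B"
    then obtain \<phi> \<psi> where h: "\<And>t. t \<in> {0..1::real} \<Longrightarrow> (\<phi> t, \<psi> t) \<in> Cuntz_pairs B"
      "c = (\<phi> 0, \<psi> 0)" "d = (\<phi> 1, \<psi> 1)"
      "\<And>z. strict_continuous_on B {0..1} (\<lambda>t. \<phi> t z)"
      "\<And>z. strict_continuous_on B {0..1} (\<lambda>t. \<psi> t z)"
      "\<And>z. continuous_on {0..1} (\<lambda>t. \<phi> t z - \<psi> t z)"
      by (rule Cuntz_homotopyE) blast
    have rev: "continuous_on {0..1} (\<lambda>t::real. 1 - t)" by (intro continuous_intros)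
    have "strict_continuous_on B {0..1} (\<lambda>t. \<phi> (1 - t) z)"
      "strict_continuous_on B {0..1} (\<lambda>t. \<psi> (1 - t) z)"
      "continuous_on {0..1} (\<lambda>t. \<phi> (1 - t) z - \<psi> (1 - t) z)" for z
      using strict_continuous_on_compose[OF h(4)[of z] rev] strict_continuous_on_compose[OF h(5)[of z] rev]
        continuous_on_compose2[OF h(6)[of z] rev]
      by auto
    then show "(d, c) \<in> Cuntz_homotopy B"
      using h(1-3) Cuntz_homotopyI[of "\<lambda>t. \<phi> (1 - t)" "\<lambda>t. \<psi> (1 - t)" B] by simp
  qed
  show "trans (Cuntz_homotopy B)"
  proof (rule transI)
    fix c d e assume cd: "(c, d) \<in> Cuntz_homotopy B" and de: "(d, e) \<in> Cuntz_homotopy B"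
    obtain \<phi> \<psi> where h: "\<And>t. t \<in> {0..1::real} \<Longrightarrow> (\<phi> t, \<psi> t) \<in> Cuntz_pairs B"
      "c = (\<phi> 0, \<psi> 0)" "d = (\<phi> 1, \<psi> 1)"
      "\<And>z. strict_continuous_on B {0..1} (\<lambda>t. \<phi> t z)"
      "\<And>z. strict_continuous_on B {0..1} (\<lambda>t. \<psi> t z)"
      "\<And>z. continuous_on {0..1} (\<lambda>t. \<phi> t z - \<psi> t z)"
      using cd by (rule Cuntz_homotopyE) blast
    obtain \<phi>' \<psi>' where h': "\<And>t. t \<in> {0..1::real} \<Longrightarrow> (\<phi>' t, \<psi>' t) \<in> Cuntz_pairs B"
      "d = (\<phi>' 0, \<psi>' 0)" "e = (\<phi>' 1, \<psi>' 1)"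
      "\<And>z. strict_continuous_on B {0..1} (\<lambda>t. \<phi>' t z)"
      "\<And>z. strict_continuous_on B {0..1} (\<lambda>t. \<psi>' t z)"
      "\<And>z. continuous_on {0..1} (\<lambda>t. \<phi>' t z - \<psi>' t z)"
      using de by (rule Cuntz_homotopyE) blast
    have pt: "\<phi> 1 = \<phi>' 0" "\<psi> 1 = \<psi>' 0" using h(3) h'(2) by auto
    define \<alpha> where "\<alpha> = \<phi> +++ \<phi>'"
    define \<beta> where "\<beta> = \<psi> +++ \<psi>'"
    have \<alpha>: "(\<lambda>t. \<alpha> t z) = (\<lambda>t. \<phi> t z) +++ (\<lambda>t. \<phi>' t z)"
      and \<beta>: "(\<lambda>t. \<beta> t z) = (\<lambda>t. \<psi> t z) +++ (\<lambda>t. \<psi>' t z)"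
      and \<alpha>\<beta>: "(\<lambda>t. \<alpha> t z - \<beta> t z) = (\<lambda>t. \<phi> t z - \<psi> t z) +++ (\<lambda>t. \<phi>' t z - \<psi>' t z)" for z
      by (auto simp: \<alpha>_def \<beta>_def joinpaths_def fun_eq_iff)
    have "strict_continuous_on B {0..1} (\<lambda>t. \<alpha> t z)" "strict_continuous_on B {0..1} (\<lambda>t. \<beta> t z)"
      "continuous_on {0..1} (\<lambda>t. \<alpha> t z - \<beta> t z)" for z
      unfolding \<alpha> \<beta> \<alpha>\<beta> using h(4-6)[of z] h'(4-6)[of z] pt
      by (auto intro!: strict_continuous_on_joinpaths continuous_on_joinpaths
          simp: pathfinish_def pathstart_def)
    moreover have "(\<alpha> t, \<beta> t) \<in> Cuntz_pairs B" if "t \<in> {0..1}" for t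
      using that h(1)[of "2 * t"] h'(1)[of "2 * t - 1"] by (auto simp: \<alpha>_def \<beta>_def joinpaths_def)
    moreover have "\<alpha> 0 = \<phi> 0" "\<beta> 0 = \<psi> 0" "\<alpha> 1 = \<phi>' 1" "\<beta> 1 = \<psi>' 1"
      by (auto simp: \<alpha>_def \<beta>_def joinpaths_def)
    ultimately show "(c, e) \<in> Cuntz_homotopy B"
      using h(2) h'(3) Cuntz_homotopyI[of \<alpha> \<beta> B] by simp
  qed
qed

lemma Cuntz_class_self: "c \<in> Cuntz_pairs B \<Longrightarrow> c \<in> Cuntz_class B c"
  unfolding Cuntz_class_def by (rule equiv_class_self[OF equiv_Cuntz_homotopy])

lemma star_hom_projection:
  assumes "projection p"
  shows "star_hom (\<lambda>z. z *\<^sub>C p)"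
  using assms unfolding star_hom_def projection_def
  by (simp add: scaleC_add_left scaleC_complex_def scaleC_scaleC scaleC_mult_left scaleC_mult_right
      star_scaleC star_complex_def mult.commute)

lemma projection_diff:
  assumes "projection e" "projection f" "e * f = f"
  shows "projection (e - f)" "f * e = f"
proof -
  have e: "e * e = e" "star e = e" "f * f = f" "star f = f" using assms by (auto simp: projection_def)
  show fe: "f * e = f" using arg_cong[OF assms(3), of star] e by (simp add: star_mult)
  show "projection (e - f)"
    unfolding projection_def using e fe assms(3)
    by (simp add: star_diff left_diff_distrib right_diff_distrib)
qed

lemma projection_add:
  assumes "projection e" "projection f" "e * f = 0"
  shows "projection (e + f)"
proof -
  have e: "e * e = e" "star e = e" "f * f = f" "star f = f" using assms by (auto simp: projection_def)
  have "f * e = 0" using arg_cong[OF assms(3), of star] e by (simp add: star_mult)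
  then show ?thesis
    unfolding projection_def using e assms(3) by (simp add: star_add distrib_left distrib_right)
qed

lemma projection_range:
  assumes "projection (star v * v)"
  shows "projection (v * star v)"
  using partial_isometry_mult_initial[OF assms]
  by (simp add: projection_def star_mult star_star) (metis mult.assoc)

lemma projection_conj:
  assumes "projection a" "star s * s = 1"
  shows "projection (s * a * star s)"
proof -
  have "a * star s * (s * a) = a" using assms by (metis mult.assoc mult.right_neutral projection_def)
  then have "s * a * star s * (s * a * star s) = s * a * star s"
    by (metis mult.assoc)
  then show ?thesis using assms by (simp add: projection_def star_mult star_star mult.assoc)
qed

text \<open>Inserting the unit \<open>s * star s + t * star t\<close> between \<open>star s\<close>
  and \<open>t\<close> shows that \<open>star s * t\<close> equals twice itself.\<close>

lemma isometries_orthogonal: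
  fixes s t :: "'a::cstar_algebra_1"
  assumes "star s * s = 1" "star t * t = 1" "s * star s + t * star t = 1"
  shows "star s * t = 0"
proof -
  have "star s * t = star s * (s * star s + t * star t) * t" using assms by simp
  also have "\<dots> = (star s * s) * star s * t + star s * t * (star t * t)"
    by (simp only: distrib_left distrib_right mult.assoc)
  finally show ?thesis using assms by simp
qed

section \<open>Classes of pairs of projections in KK and their splitting\<close>

context proper_ideal
begin

definition cl :: "'a \<Rightarrow> 'a \<Rightarrow> 'a cpair set" where
  "cl p q = Cuntz_class B (pair_of_projections p q)"

lemma pair_of_projections_in:
  assumes "projection p" "projection q" "p - q \<in> B"
  shows "pair_of_projections p q \<in> Cuntz_pairs B"
  using assms unfolding Cuntz_pairs_def pair_of_projections_def
  by (auto intro: star_hom_projection ideal_closed simp flip: scaleC_diff_right)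

lemma cl_in_carrier: "projection p \<Longrightarrow> projection q \<Longrightarrow> p - q \<in> B \<Longrightarrow> cl p q \<in> carrier (KK_complex B)"
  by (simp add: cl_def Cuntz_class_def KK_complex_def quotientI pair_of_projections_in)

lemma cl_zero: "cl 0 0 = one (KK_complex B)"
  by (simp add: cl_def pair_of_projections_def KK_complex_def)

text \<open>Norm continuity of the two paths yields all three continuity conditions of a Cuntz
  homotopy at once.\<close>

lemma cl_homotopy:
  assumes "\<And>t. t \<in> {0..1::real} \<Longrightarrow> projection (p t) \<and> projection (q t) \<and> p t - q t \<in> B"
    and c: "continuous_on {0..1} p" "continuous_on {0..1} q"
  shows "cl (p 0) (q 0) = cl (p 1) (q 1)"
proof -
  have cont: "continuous_on {0..1} (\<lambda>t. z *\<^sub>C p t)" "continuous_on {0..1} (\<lambda>t. z *\<^sub>C q t)" for z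
    using c by (auto intro: bounded_linear.continuous_on[OF bounded_linear_scaleC])
  have "(pair_of_projections (p 0) (q 0), pair_of_projections (p 1) (q 1)) \<in> Cuntz_homotopy B"
    unfolding pair_of_projections_def
    using pair_of_projections_in[unfolded pair_of_projections_def] assms(1) cont
    by (intro Cuntz_homotopyI[of "\<lambda>t z. z *\<^sub>C p t" "\<lambda>t z. z *\<^sub>C q t"]
        continuous_on_imp_strict continuous_on_diff) auto
  then show ?thesis
    unfolding cl_def Cuntz_class_def by (rule equiv_class_eq[OF equiv_Cuntz_homotopy])
qed

text \<open>The product of two classes is a union over all such pairs \<open>s\<close>,
  \<open>t\<close>, so without any pair it would be empty. But the unit class contains the zero pair
  and equals its own square.\<close>

lemma exists_isometries:
  assumes "group (KK_complex B)"
  obtains s t :: 'a where "star s * s = 1" "star t * t = 1" "s * star s + t * star t = 1"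
proof -
  interpret group "KK_complex B" by fact
  have "cl 0 0 \<otimes>\<^bsub>KK_complex B\<^esub> cl 0 0 = cl 0 0" by (simp add: cl_zero)
  moreover have "pair_of_projections 0 0 \<in> cl 0 0"
    unfolding cl_def by (intro Cuntz_class_self pair_of_projections_in) (auto simp: ideal_closed)
  ultimately have "pair_of_projections 0 0 \<in> cl 0 0 \<otimes>\<^bsub>KK_complex B\<^esub> cl 0 0" by simp
  then show ?thesis using that by (auto simp: KK_complex_def)
qed

text \<open>
  The product of two classes is defined as a union of classes. As the group axioms make it a
  class again, it coincides with each member of the union.
\<close>

lemma cl_mult:
  assumes G: "group (KK_complex B)"
    and st: "star s * s = 1" "star t * t = 1" "s * star s + t * star t = 1"
    and pq: "projection p" "projection q" "p - q \<in> B"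
    and pq': "projection p'" "projection q'" "p' - q' \<in> B"
  shows "cl p q \<otimes>\<^bsub>KK_complex B\<^esub> cl p' q' =
    cl (s * p * star s + t * p' * star t) (s * q * star s + t * q' * star t)"
proof -
  interpret group "KK_complex B" by (rule G)
  define P where "P = s * p * star s + t * p' * star t"
  define Q where "Q = s * q * star s + t * q' * star t"
  note s_t = isometries_orthogonal[OF st]
  have orth: "s * a * star s * (t * b * star t) = 0" for a b
  proof -
    have "s * a * star s * (t * b * star t) = s * a * (star s * t) * b * star t"
      by (simp add: mult.assoc)
    then show ?thesis by (simp add: s_t)
  qed
  have P: "projection P" "projection Q"
    unfolding P_def Q_def using st pq pq' by (auto intro!: projection_add projection_conj orth)
  have "P - Q = s * (p - q) * star s + t * (p' - q') * star t"
    by (simp add: P_def Q_def algebra_simps)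
  then have PQ: "P - Q \<in> B" using pq pq' by (simp add: ideal_closed)
  have inC: "pair_of_projections p q \<in> cl p q" "pair_of_projections p' q' \<in> cl p' q'"
    "pair_of_projections P Q \<in> cl P Q"
    using pair_of_projections_in[OF pq] pair_of_projections_in[OF pq'] pair_of_projections_in[OF P PQ]
    by (auto simp: cl_def intro: Cuntz_class_self)
  have "Cuntz_sum s t (pair_of_projections p q) (pair_of_projections p' q') = pair_of_projections P Q"
    by (simp add: Cuntz_sum_def pair_of_projections_def P_def Q_def scaleC_add_right
        scaleC_mult_left scaleC_mult_right)
  then have "pair_of_projections P Q \<in> Cuntz_class B
      (Cuntz_sum s t (pair_of_projections p q) (pair_of_projections p' q'))"
    using inC(3) by (simp add: cl_def)
  then have "pair_of_projections P Q \<in> (\<Union>c\<in>cl p q. \<Union>d\<in>cl p' q'.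
      \<Union>(s, t)\<in>{(s, t). star s * s = 1 \<and> star t * t = 1 \<and> s * star s + t * star t = 1}.
        Cuntz_class B (Cuntz_sum s t c d))"
    using st by (intro UN_I[OF inC(1)] UN_I[OF inC(2)] UN_I[of "(s, t)"]) simp_all
  then have mem: "pair_of_projections P Q \<in> cl p q \<otimes>\<^bsub>KK_complex B\<^esub> cl p' q'"
    by (simp add: KK_complex_def)
  have "cl p q \<otimes>\<^bsub>KK_complex B\<^esub> cl p' q' \<in> carrier (KK_complex B)"
    using pq pq' by (intro m_closed cl_in_carrier)
  then obtain c where c: "cl p q \<otimes>\<^bsub>KK_complex B\<^esub> cl p' q' = Cuntz_homotopy B `` {c}"
    by (auto simp: KK_complex_def elim: quotientE)
  then have "(c, pair_of_projections P Q) \<in> Cuntz_homotopy B" using mem by auto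
  then have "Cuntz_homotopy B `` {c} = cl P Q"
    unfolding cl_def Cuntz_class_def by (rule equiv_class_eq[OF equiv_Cuntz_homotopy])
  then show ?thesis using c by (simp add: P_def Q_def)
qed

text \<open>Orthogonality of \<open>x\<close> and \<open>y\<close> keeps
  \<open>star (V t) * V t = f\<close>, so \<open>V t\<close> stays a partial isometry while its
  range turns from that of \<open>x\<close> to that of \<open>y\<close>. As \<open>R\<close>
  annihilates \<open>x\<close> and \<open>y\<close>, it is orthogonal to every range in between.
  Both entries of the pair move, but their difference is always \<open>R\<close>, an element of
  \<open>B\<close>.\<close>

lemma cl_rotate:
  assumes R: "R \<in> B" "projection R" "R * x = 0" "R * y = 0"
    and xy: "star x * x = f" "star y * y = f" "star x * y = 0" and f: "projection f"
  shows "cl (R + x * star x) (x * star x) = cl (R + y * star y) (y * star y)"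
proof -
  \<comment> \<open>A quarter turn: \<open>V 0 = x\<close> and \<open>V 1 = y\<close>.\<close>
  define V where "V = (\<lambda>t::real. cos (t * (pi / 2)) *\<^sub>R x + sin (t * (pi / 2)) *\<^sub>R y)"
  have yx: "star y * x = 0" using arg_cong[OF xy(3), of star] by (simp add: star_mult star_star)
  have VV: "star (V t) * V t = f" for t
  proof -
    define \<theta> where "\<theta> = t * (pi / 2)"
    have "star (V t) * V t = (cos \<theta> * cos \<theta> + sin \<theta> * sin \<theta>) *\<^sub>R f"
      unfolding scaleR_left_distrib V_def \<theta>_def[symmetric]
      by (simp add: star_add star_scaleR distrib_left distrib_right xy yx)
    then show ?thesis by simp
  qed
  have p: "projection (V t * star (V t))" for t
    using f by (intro projection_range) (simp add: VV)
  have RV: "R * (V t * star (V t)) = 0" for t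
  proof -
    have "R * V t = 0" by (simp add: V_def distrib_left R)
    then show ?thesis by (simp add: mult.assoc[symmetric])
  qed
  have cV: "continuous_on {0..1} V" unfolding V_def by (intro continuous_intros)
  have "cl (R + V 0 * star (V 0)) (V 0 * star (V 0)) = cl (R + V 1 * star (V 1)) (V 1 * star (V 1))"
    using R(1,2) p RV cV
    by (intro cl_homotopy[of "\<lambda>t. R + V t * star (V t)" "\<lambda>t. V t * star (V t)"])
      (auto intro!: projection_add continuous_intros)
  then show ?thesis by (simp add: V_def)
qed

text \<open>The range of \<open>T\<close> is moved into the half of the unit cut out by
  \<open>t\<close>, where it meets neither \<open>R\<close> nor the range of \<open>x\<close>,
  whatever its position relative to \<open>e\<close>.\<close>

lemma cl_split:
  assumes G: "group (KK_complex B)"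
    and e: "projection e" and T: "projection (star T * T)" "e * (star T * T) = star T * T"
      "e - star T * T \<in> B"
  shows "cl e (star T * T) =
    cl (e - star T * T) 0 \<otimes>\<^bsub>KK_complex B\<^esub> cl (T * star T) (T * star T)"
proof -
  interpret group "KK_complex B" by (rule G)
  obtain s t :: 'a where st: "star s * s = 1" "star t * t = 1" "s * star s + t * star t = 1"
    using exists_isometries[OF G] by blast
  define f where "f = star T * T"
  have f: "projection f" "f * f = f" "star f = f" and ef: "e * f = f" "e - f \<in> B"
    using T by (auto simp: f_def projection_def)
  have Tf: "T * f = T" using partial_isometry_mult_initial[OF T(1)] by (simp add: f_def)
  note r = projection_diff(1)[OF e f(1) ef(1)]
  note s_t = isometries_orthogonal[OF st]
  define R where "R = s * (e - f) * star s"
  define x where "x = s * f"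
  define y where "y = t * T"
  have sl: "star s * (s * a) = a" "star t * (t * a) = a" "star s * (t * a) = 0" for a
    using st s_t by (simp_all add: mult.assoc[symmetric])
  \<comment> \<open>The class of the zero pair is neutral; adding it frees the half of the unit
    given by \<open>t * star t\<close>.\<close>
  have "cl e f = cl e f \<otimes>\<^bsub>KK_complex B\<^esub> cl 0 0"
    using cl_in_carrier[OF e f(1) ef(2)] by (simp add: cl_zero)
  also have "\<dots> = cl (s * e * star s) (s * f * star s)"
    using cl_mult[OF G st e f(1) ef(2), of 0 0] by (simp add: ideal_closed)
  also have "s * e * star s = R + s * f * star s" by (simp add: R_def algebra_simps)
  also have "s * f * star s = x * star x"
    using f(2,3) by (simp add: x_def star_mult mult.assoc) (metis mult.assoc)
  also have "cl (R + x * star x) (x * star x) = cl (R + y * star y) (y * star y)"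
  proof (rule cl_rotate)
    show "R \<in> B" using ef by (simp add: R_def ideal_closed)
    show "projection R" unfolding R_def by (rule projection_conj[OF r st(1)])
    show "R * x = 0" "R * y = 0" using ef(1) f(2)
      by (simp_all add: R_def x_def y_def mult.assoc sl left_diff_distrib)
    show "star x * x = f" "star y * y = f" "star x * y = 0"
      using f by (simp_all add: x_def y_def star_mult mult.assoc sl) (simp add: f_def)
  qed (rule f(1))
  also have "y * star y = t * (T * star T) * star t" by (simp add: y_def star_mult mult.assoc)
  \<comment> \<open>The addition formula read backwards: the \<open>s\<close>-part of the pair is
    \<open>e - f\<close> against 0, the \<open>t\<close>-part is the range projection of
    \<open>T\<close> in both entries.\<close>
  also have "cl (R + t * (T * star T) * star t) (t * (T * star T) * star t)
      = cl (e - f) 0 \<otimes>\<^bsub>KK_complex B\<^esub> cl (T * star T) (T * star T)"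
    using cl_mult[OF G st r projection_zero _ projection_range[OF T(1)] projection_range[OF T(1)]] ef
    by (simp add: R_def ideal_closed)
  finally show ?thesis by (simp add: f_def)
qed

lemma K0_diff_ess_codim:
  assumes iso: "KK_K0_iso B \<Phi>"
    and e: "projection e" "projection e'"
    and T: "projection (star T * T)" "e * (star T * T) = star T * T" "e' * (T * star T) = T * star T"
    and d: "e - star T * T \<in> B" "e' - T * star T \<in> B"
  shows "K0_diff B (ess_codim B \<Phi> e (star T * T)) (ess_codim B \<Phi> e' (T * star T))
    = K0_diff B (K0_class B (e - star T * T)) (K0_class B (e' - T * star T))"
proof -
  have G: "group (KK_complex B)" and H: "group (K0 B)"
    and hom: "\<Phi> \<in> hom (KK_complex B) (K0 B)"
    and val: "\<And>p q. p \<in> B \<Longrightarrow> q \<in> B \<Longrightarrow> projection p \<Longrightarrow> projection q \<Longrightarrow>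
      \<Phi> (cl p q) = K0_diff B (K0_class B p) (K0_class B q)"
    using iso by (auto simp: KK_K0_iso_def iso_def cl_def)
  interpret KK: group "KK_complex B" by (rule G)
  interpret K0: group "K0 B" by (rule H)
  let ?f = "star T * T" and ?f' = "T * star T"
  have f': "projection ?f'" by (rule projection_range[OF T(1)])
  have r: "projection (e - ?f)" "projection (e' - ?f')"
    using projection_diff(1) e T f' by auto
  \<comment> \<open>The normalization of \<open>\<Phi>\<close> with second projection 0, whose class
    is the unit of \<open>K0 B\<close>.\<close>
  have v: "\<Phi> (cl p 0) = K0_class B p" if "p \<in> B" "projection p" for p
    using val[OF that(1) _ that(2), of 0] K0_class_carrier[OF that]
    by (simp add: ideal_closed K0_diff_def K0_class_zero)
  have C: "\<Phi> (cl p q) \<in> carrier (K0 B)" if "projection p" "projection q" "p - q \<in> B" for p q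
    using hom cl_in_carrier[OF that] by (auto simp: hom_def)
  have m: "\<Phi> (cl p 0 \<otimes>\<^bsub>KK_complex B\<^esub> cl ?f' ?f') = K0_class B p \<otimes>\<^bsub>K0 B\<^esub> \<Phi> (cl ?f' ?f')"
    if "p \<in> B" "projection p" for p
    using hom_mult[OF hom cl_in_carrier cl_in_carrier] that f' by (simp add: v ideal_closed)
  have 1: "ess_codim B \<Phi> e ?f = K0_class B (e - ?f) \<otimes>\<^bsub>K0 B\<^esub> \<Phi> (cl ?f' ?f')"
    using cl_split[OF G e(1) T(1,2) d(1)] m[OF d(1) r(1)] by (simp add: ess_codim_def cl_def)
  \<comment> \<open>For \<open>e'\<close> the projection \<open>T * star T\<close> itself serves as
    the partial isometry in \<open>cl_split\<close>. Its initial and final projections coincide, so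
    the degenerate summand is the one already obtained for \<open>e\<close>.\<close>
  have ff: "star ?f' * ?f' = ?f'" "?f' * star ?f' = ?f'"
    using f' by (auto simp: projection_def)
  have 2: "ess_codim B \<Phi> e' ?f' = K0_class B (e' - ?f') \<otimes>\<^bsub>K0 B\<^esub> \<Phi> (cl ?f' ?f')"
    using cl_split[OF G e(2), of ?f'] f' T(3) d(2) m[OF d(2) r(2)]
    unfolding ff by (simp add: ess_codim_def cl_def)
  have c: "K0_class B (e - ?f) \<in> carrier (K0 B)" "K0_class B (e' - ?f') \<in> carrier (K0 B)"
    "\<Phi> (cl ?f' ?f') \<in> carrier (K0 B)"
    using d r f' by (auto intro!: K0_class_carrier C simp: ideal_closed)
  \<comment> \<open>The common factor \<open>x\<close> stands on the right in both products;
    inverting the second one puts \<open>x\<close> next to its inverse, so the cancellation is valid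
    in any group.\<close>
  have "(a \<otimes>\<^bsub>K0 B\<^esub> x) \<otimes>\<^bsub>K0 B\<^esub> inv\<^bsub>K0 B\<^esub> (b \<otimes>\<^bsub>K0 B\<^esub> x) = a \<otimes>\<^bsub>K0 B\<^esub> inv\<^bsub>K0 B\<^esub> b"
    if "a \<in> carrier (K0 B)" "b \<in> carrier (K0 B)" "x \<in> carrier (K0 B)" for a b x
  proof -
    have "(a \<otimes>\<^bsub>K0 B\<^esub> x) \<otimes>\<^bsub>K0 B\<^esub> inv\<^bsub>K0 B\<^esub> (b \<otimes>\<^bsub>K0 B\<^esub> x)
        = a \<otimes>\<^bsub>K0 B\<^esub> (x \<otimes>\<^bsub>K0 B\<^esub> inv\<^bsub>K0 B\<^esub> x) \<otimes>\<^bsub>K0 B\<^esub> inv\<^bsub>K0 B\<^esub> b"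
      using that by (simp only: K0.inv_mult_group K0.m_assoc K0.m_closed K0.inv_closed)
    then show ?thesis using that by simp
  qed
  then show ?thesis unfolding 1 2 K0_diff_def using c by simp
qed

end

section \<open>Multipliers and the defects of the partial isometries\<close>

lemma bounded_imageE:
  assumes "bounded (f ` S)"
  obtains K where "K > 0" "\<And>x. x \<in> S \<Longrightarrow> norm (f x) \<le> K"
  using assms unfolding bounded_pos by blast

lemma eventually_at_infinity_principal: "\<forall>\<^sub>F x in inf at_infinity (principal S). x \<in> S"
  by (simp add: eventually_inf_principal)

text \<open>Continuity is relative to \<open>S\<close>, and the limit is taken along a filter
  concentrated on \<open>S\<close>, so values elsewhere do not enter.\<close>

lemma C0_norm_cong:
  assumes "\<And>x. x \<in> S \<Longrightarrow> f x = g x" "f \<in> C0_norm B S"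
  shows "g \<in> C0_norm B S"
proof -
  have "(g \<longlongrightarrow> 0) (inf at_infinity (principal S))"
  proof (rule Lim_transform_eventually)
    show "(f \<longlongrightarrow> 0) (inf at_infinity (principal S))" using assms(2) by (simp add: C0_norm_def)
    show "\<forall>\<^sub>F x in inf at_infinity (principal S). f x = g x"
      using eventually_at_infinity_principal by eventually_elim (rule assms(1))
  qed
  moreover have "continuous_on S g"
    using assms continuous_on_cong[OF refl assms(1)] by (auto simp: C0_norm_def)
  ultimately show ?thesis using assms by (force simp: C0_norm_def)
qed

lemma connected_piece: "connected (piece X n x i)"
proof -
  have "is_interval (points X)" by (cases X) (auto simp: is_interval_1)
  then have "is_interval (piece X n x i)" by (auto simp: piece_def is_interval_1)
  then show ?thesis by (simp add: is_interval_connected_1)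
qed

section \<open>Strictly continuous functions as multipliers of norm continuous ones\<close>

context proper_ideal
begin

text \<open>Split \<open>f x * g x - f a * g a\<close> into \<open>f x * (g x - g a)\<close>, which
  is small because \<open>f\<close> is bounded, and \<open>(f x - f a) * g a\<close>, which is small
  by strict continuity because \<open>g a \<in> B\<close>.\<close>

lemma continuous_on_strict_mult:
  assumes f: "f \<in> Cb_strict B S" and g: "g ` S \<subseteq> B" "continuous_on S g"
  shows "continuous_on S (\<lambda>x. f x * g x)" "continuous_on S (\<lambda>x. g x * f x)"
proof -
  obtain K where K: "K > 0" "\<And>x. x \<in> S \<Longrightarrow> norm (f x) \<le> K"
    using f by (auto simp: Cb_strict_def elim: bounded_imageE)
  have *: "((\<lambda>x. f x * g x) \<longlongrightarrow> f a * g a) (at a within S) \<and>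
      ((\<lambda>x. g x * f x) \<longlongrightarrow> g a * f a) (at a within S)" if a: "a \<in> S" for a
  proof
    have S: "\<forall>\<^sub>F x in at a within S. x \<in> S" by (simp add: eventually_at_filter)
    have "((\<lambda>x. g x - g a) \<longlongrightarrow> 0) (at a within S)"
      using g(2) a LIM_zero by (auto simp: continuous_on_def)
    then have z: "((\<lambda>x. K * norm (g x - g a)) \<longlongrightarrow> 0) (at a within S)"
      by (intro tendsto_mult_right_zero tendsto_norm_zero)
    have ga: "g a \<in> B" using g a by blast
    have s: "((\<lambda>x. f x * g a) \<longlongrightarrow> f a * g a) (at a within S)"
      "((\<lambda>x. g a * f x) \<longlongrightarrow> g a * f a) (at a within S)"
      using f ga a by (auto simp: Cb_strict_def strict_continuous_on_def continuous_on_def)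
    have "((\<lambda>x. f x * (g x - g a)) \<longlongrightarrow> 0) (at a within S)"
    proof (rule Lim_null_comparison[OF _ z], use S in eventually_elim)
      case (elim x)
      then show ?case using K norm_mult_ineq[of "f x" "g x - g a"]
        by (meson mult_right_mono norm_ge_zero order.trans)
    qed
    from tendsto_add[OF this s(1)] show "((\<lambda>x. f x * g x) \<longlongrightarrow> f a * g a) (at a within S)"
      by (simp add: algebra_simps)
    have "((\<lambda>x. (g x - g a) * f x) \<longlongrightarrow> 0) (at a within S)"
    proof (rule Lim_null_comparison[OF _ z], use S in eventually_elim)
      case (elim x)
      then show ?case using K norm_mult_ineq[of "g x - g a" "f x"]
        by (metis mult.commute mult_right_mono norm_ge_zero order.trans)
    qed
    from tendsto_add[OF this s(2)] show "((\<lambda>x. g x * f x) \<longlongrightarrow> g a * f a) (at a within S)"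
      by (simp add: algebra_simps)
  qed
  show "continuous_on S (\<lambda>x. f x * g x)" "continuous_on S (\<lambda>x. g x * f x)"
    using * by (auto simp: continuous_on_def)
qed

text \<open>For \<open>b \<in> B\<close> the function \<open>g x * b\<close> is norm continuous with
  values in \<open>B\<close>, so \<open>continuous_on_strict_mult\<close> applies to
  \<open>f\<close> and this function; the other side is symmetric.\<close>

lemma Cb_strict_mult:
  assumes f: "f \<in> Cb_strict B S" and g: "g \<in> Cb_strict B S"
  shows "(\<lambda>x. f x * g x) \<in> Cb_strict B S"
proof -
  obtain K where K: "K > 0" "\<And>x. x \<in> S \<Longrightarrow> norm (f x) \<le> K"
    using f by (auto simp: Cb_strict_def elim: bounded_imageE)
  obtain L where L: "L > 0" "\<And>x. x \<in> S \<Longrightarrow> norm (g x) \<le> L"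
    using g by (auto simp: Cb_strict_def elim: bounded_imageE)
  have "norm (f x * g x) \<le> K * L" if "x \<in> S" for x
    using norm_mult_ineq[of "f x" "g x"] mult_mono[OF K(2)[OF that] L(2)[OF that]] K(1) by simp
  then have "bounded ((\<lambda>x. f x * g x) ` S)" by (auto intro!: boundedI)
  moreover have "continuous_on S (\<lambda>x. f x * (g x * b))" "continuous_on S (\<lambda>x. b * f x * g x)"
    if "b \<in> B" for b
  proof -
    have "(\<lambda>x. g x * b) ` S \<subseteq> B" "continuous_on S (\<lambda>x. g x * b)"
      "(\<lambda>x. b * f x) ` S \<subseteq> B" "continuous_on S (\<lambda>x. b * f x)"
      using f g that by (auto simp: Cb_strict_def strict_continuous_on_def ideal_closed)
    then show "continuous_on S (\<lambda>x. f x * (g x * b))" "continuous_on S (\<lambda>x. b * f x * g x)"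
      using continuous_on_strict_mult(1)[OF f] continuous_on_strict_mult(2)[OF g] by blast+
  qed
  ultimately show ?thesis by (simp add: Cb_strict_def strict_continuous_on_def mult.assoc)
qed

text \<open>\<open>star (f x) * b\<close> is the adjoint of \<open>star b * f x\<close>, and
  \<open>star b\<close> is again in \<open>B\<close> because closed ideals are self-adjoint.\<close>

lemma Cb_strict_star:
  assumes f: "f \<in> Cb_strict B S"
  shows "(\<lambda>x. star (f x)) \<in> Cb_strict B S"
proof -
  have "bounded ((\<lambda>x. star (f x)) ` S)" using f by (auto simp: Cb_strict_def bounded_iff)
  moreover have "continuous_on S (\<lambda>x. star (star b * f x))" "continuous_on S (\<lambda>x. star (f x * star b))"
    if "b \<in> B" for b
    using f star_in_ideal[OF that]
    by (auto intro!: continuous_on_star simp: Cb_strict_def strict_continuous_on_def)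
  ultimately show ?thesis by (simp add: Cb_strict_def strict_continuous_on_def star_mult star_star)
qed

lemma C0_norm_mult:
  assumes f: "f \<in> Cb_strict B S" and g: "g \<in> C0_norm B S"
  shows "(\<lambda>x. f x * g x) \<in> C0_norm B S" "(\<lambda>x. g x * f x) \<in> C0_norm B S"
proof -
  obtain K where K: "K > 0" "\<And>x. x \<in> S \<Longrightarrow> norm (f x) \<le> K"
    using f by (auto simp: Cb_strict_def elim: bounded_imageE)
  have gS: "g ` S \<subseteq> B" "continuous_on S g" "(g \<longlongrightarrow> 0) (inf at_infinity (principal S))"
    using g by (auto simp: C0_norm_def)
  have z: "((\<lambda>x. K * norm (g x)) \<longlongrightarrow> 0) (inf at_infinity (principal S))"
    using gS(3) by (intro tendsto_mult_right_zero tendsto_norm_zero)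
  have "((\<lambda>x. f x * g x) \<longlongrightarrow> 0) (inf at_infinity (principal S))"
  proof (rule Lim_null_comparison[OF _ z], use eventually_at_infinity_principal in eventually_elim)
    case (elim x)
    then show ?case using K norm_mult_ineq[of "f x" "g x"]
      by (meson mult_right_mono norm_ge_zero order.trans)
  qed
  then show "(\<lambda>x. f x * g x) \<in> C0_norm B S"
    using continuous_on_strict_mult[OF f gS(1,2)] gS(1) by (auto simp: C0_norm_def ideal_closed)
  have "((\<lambda>x. g x * f x) \<longlongrightarrow> 0) (inf at_infinity (principal S))"
  proof (rule Lim_null_comparison[OF _ z], use eventually_at_infinity_principal in eventually_elim)
    case (elim x)
    then show ?case using K norm_mult_ineq[of "g x" "f x"]
      by (metis mult.commute mult_right_mono norm_ge_zero order.trans)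
  qed
  then show "(\<lambda>x. g x * f x) \<in> C0_norm B S"
    using continuous_on_strict_mult[OF f gS(1,2)] gS(1) by (auto simp: C0_norm_def ideal_closed)
qed

lemma C0_norm_zero: "(\<lambda>_. 0) \<in> C0_norm B S"
  by (auto simp: C0_norm_def ideal_closed)

lemma C0_norm_add: "f \<in> C0_norm B S \<Longrightarrow> g \<in> C0_norm B S \<Longrightarrow> (\<lambda>x. f x + g x) \<in> C0_norm B S"
  by (auto simp: C0_norm_def ideal_closed image_subset_iff intro!: continuous_on_add tendsto_add_zero)

lemma C0_norm_minus: "f \<in> C0_norm B S \<Longrightarrow> (\<lambda>x. - f x) \<in> C0_norm B S"
  by (auto simp: C0_norm_def minus_closed image_subset_iff intro!: continuous_on_minus
      tendsto_minus_cancel_left[THEN iffD1])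

lemma C0_norm_star: "f \<in> C0_norm B S \<Longrightarrow> (\<lambda>x. star (f x)) \<in> C0_norm B S"
  using bounded_linear.tendsto_zero[OF bounded_linear_star]
  by (auto simp: C0_norm_def star_in_ideal image_subset_iff intro!: continuous_on_star)

text \<open>The defect is \<open>v * (1 - star ut * ut) * star v\<close>. Modulo the ideal,
  \<open>ut\<close> may be replaced by \<open>y\<close>, and \<open>star w * w = q\<close> reduces
  \<open>star y * y\<close> to \<open>star v * p * (star u * q * u) * p * v\<close>. Since
  \<open>star u * q * u\<close> is \<open>p\<close> modulo the ideal, this is
  \<open>star v * p * v = 1\<close> up to the ideal. The functions \<open>c\<close> and
  \<open>d\<close> record the two errors.\<close>

lemma defect_C0_norm:
  assumes M: "u \<in> Cb_strict B S" "p \<in> Cb_strict B S" "q \<in> Cb_strict B S" "v \<in> Cb_strict B S"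
      "w \<in> Cb_strict B S" "ut \<in> Cb_strict B S"
    and pq: "\<And>x. x \<in> S \<Longrightarrow> projection (p x)" "\<And>x. x \<in> S \<Longrightarrow> projection (q x)"
    and v: "\<And>x. x \<in> S \<Longrightarrow> star (v x) * v x = 1" "\<And>x. x \<in> S \<Longrightarrow> v x * star (v x) = p x"
    and w: "\<And>x. x \<in> S \<Longrightarrow> w x * star (w x) = 1" "\<And>x. x \<in> S \<Longrightarrow> star (w x) * w x = q x"
    and u: "(\<lambda>x. star (u x) * u x - p x) \<in> C0_norm B S" "(\<lambda>x. u x * star (u x) - q x) \<in> C0_norm B S"
    and ut: "(\<lambda>x. ut x - w x * (q x * u x * p x) * v x) \<in> C0_norm B S"
  shows "(\<lambda>x. p x - v x * (star (ut x) * ut x) * star (v x)) \<in> C0_norm B S"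
proof -
  note I = C0_norm_mult C0_norm_add C0_norm_minus C0_norm_star Cb_strict_mult Cb_strict_star M
  define y where "y = (\<lambda>x. w x * (q x * u x * p x) * v x)"
  define k where "k = (\<lambda>x. ut x - y x)"
  define h where "h = (\<lambda>x. star (u x) * u x)"
  define a where "a = (\<lambda>x. h x - p x)"
  define b where "b = (\<lambda>x. u x * star (u x) - q x)"
  have J: "k \<in> C0_norm B S" "a \<in> C0_norm B S" "b \<in> C0_norm B S"
    using ut u by (auto simp: k_def y_def a_def h_def b_def)
  have yM: "y \<in> Cb_strict B S" unfolding y_def by (intro I)
  have hM: "h \<in> Cb_strict B S" unfolding h_def by (intro I)
  \<comment> \<open>On \<open>S\<close> this is \<open>star y * y - star ut * ut\<close>, written so
    that each term contains \<open>k = ut - y\<close> or its adjoint.\<close>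
  define c where "c = (\<lambda>x. - (star (y x) * k x + star (k x) * ut x))"
  have c: "c \<in> C0_norm B S"
    unfolding c_def using J by (intro C0_norm_minus C0_norm_add C0_norm_mult C0_norm_star
        Cb_strict_star yM M)
  \<comment> \<open>On \<open>S\<close> this is \<open>p - star u * q * u\<close>: the term
    \<open>star u * b * u\<close> is \<open>h * h - star u * q * u\<close>, and
    \<open>p * a + a * h\<close> telescopes to \<open>h * h - p\<close>.\<close>
  define d where "d = (\<lambda>x. star (u x) * b x * u x + - (p x * a x + a x * h x))"
  have d: "d \<in> C0_norm B S"
    unfolding d_def using J by (intro C0_norm_minus C0_norm_add C0_norm_mult Cb_strict_star hM M)
  have "(\<lambda>x. v x * (c x + star (v x) * (p x * d x * p x) * v x) * star (v x)) \<in> C0_norm B S"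
    using c d by (intro C0_norm_mult C0_norm_add Cb_strict_star M)
  then show ?thesis
  proof (rule C0_norm_cong[rotated])
    fix x assume x: "x \<in> S"
    have p: "p x * p x = p x" "star (p x) = p x" and q: "q x * q x = q x" "star (q x) = q x"
      using pq x by (auto simp: projection_def)
    have pl: "p x * (p x * z) = p x * z" and ql: "q x * (q x * z) = q x * z" for z
      using p q by (metis mult.assoc)+
    have wl: "star (w x) * (w x * z) = q x * z" for z by (metis w(2)[OF x] mult.assoc)
    have pv: "p x * v x = v x" using v x by (metis mult.assoc mult.right_neutral)
    have vp: "star (v x) * p x = star (v x)"
      using arg_cong[OF pv, of star] p by (simp add: star_mult)
    have dx: "d x = p x - star (u x) * q x * u x"
      using p by (simp add: d_def a_def b_def h_def algebra_simps)
    have "star (y x) * y x = star (v x) * p x * (star (u x) * q x * u x) * p x * v x"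
      by (simp add: y_def star_mult p q mult.assoc ql wl)
    also have "\<dots> = star (v x) * (p x * (p x - d x) * p x) * v x" by (simp add: dx mult.assoc)
    also have "p x * (p x - d x) * p x = p x - p x * d x * p x"
      using p by (simp add: algebra_simps pl)
    finally have yy: "star (y x) * y x = 1 - star (v x) * (p x * d x * p x) * v x"
      using v(1)[OF x] vp by (simp add: algebra_simps)
    have "c x = star (y x) * y x - star (ut x) * ut x"
      by (simp add: c_def k_def star_diff algebra_simps)
    then have "c x + star (v x) * (p x * d x * p x) * v x = 1 - star (ut x) * ut x"
      by (simp add: yy)
    then show "v x * (c x + star (v x) * (p x * d x * p x) * v x) * star (v x)
        = p x - v x * (star (ut x) * ut x) * star (v x)"
      using v(2)[OF x] by (simp add: right_diff_distrib left_diff_distrib)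
  qed
qed

end

section \<open>Representatives in the corona algebra and the defects on one piece\<close>

lemma mem_quot_map: "(\<lambda>_. 0) \<in> J \<Longrightarrow> f \<in> quot_map M J f"
  by (auto simp: quot_map_def a_r_coset_def' fun_ring_def intro!: bexI[of _ "\<lambda>_. 0"])

lemma quot_map_eqD:
  assumes "(\<lambda>_. 0) \<in> J" "quot_map M J f = quot_map M J g"
  shows "(\<lambda>x. f x - g x) \<in> J"
proof -
  have "f \<in> quot_map M J g" using mem_quot_map[OF assms(1)] assms(2) by blast
  then obtain h where "h \<in> J" "f = (\<lambda>x. h x + g x)"
    by (auto simp: quot_map_def a_r_coset_def' fun_ring_def)
  then show ?thesis by simp
qed

text \<open>Gives access to the cosets as sets of functions: applied to \<open>u\<close> and its
  adjoint, it makes \<open>star u * u\<close> a member of \<open>P\<close> and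
  \<open>u * star u\<close> a member of \<open>Q\<close>.\<close>

lemma mult_mem_corona_mult:
  assumes "(\<lambda>_. 0) \<in> ideal_I B X" "f \<in> U" "g \<in> V"
  shows "(\<lambda>x. f x * g x) \<in> U \<otimes>\<^bsub>corona B X\<^esub> V"
  using mem_quot_map[OF assms(1), of "\<lambda>x. f x * g x" "mult_I B X"] assms(2,3)
  by (auto simp: corona_def FactRing_def rcoset_mult_def quot_map_def fun_ring_def)

theorem proposition3p6:
  fixes B :: "'m::cstar_algebra_1 set"
    and X :: base_space and n :: nat and x :: "nat \<Rightarrow> real"
    and P Q :: "(real \<Rightarrow> 'm) set"
    and p q T :: "nat \<Rightarrow> real \<Rightarrow> 'm"
    and \<Phi> :: "'m cpair set \<Rightarrow> 'm K0_elem"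
  assumes "is_multiplier_algebra_of B"
    and "simple_cstar B"
    and "stable_cstar B"
    and "real_rank_zero TYPE('m)"
    and "KK_K0_iso B \<Phi>"
    and "is_partition X n x"
    and "corona_projection B X P"
    and "corona_projection B X Q"
    and "local_lifting B X n x P p"
    and "local_lifting B X n x Q q"
    and "\<And>i s. i \<le> n \<Longrightarrow> s \<in> piece X n x i \<Longrightarrow> full (p i s) \<and> properly_infinite (p i s)"
    and "\<And>i s. i \<le> n \<Longrightarrow> s \<in> piece X n x i \<Longrightarrow> full (q i s) \<and> properly_infinite (q i s)"
    and "corona_mvn_equiv B X P Q"
    and "associated_isometries B X n x P Q p q T"
  shows "\<forall>i\<le>n. \<forall>s\<in>piece X n x i.
    defect_class B (piece X n x i) (p i) (q i) (T i) =
      K0_diff B (ess_codim B \<Phi> (p i s) (star (T i s) * T i s))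
                (ess_codim B \<Phi> (q i s) (T i s * star (T i s)))"
proof (intro allI impI ballI)
  fix i s assume i: "i \<le> n" and s: "s \<in> piece X n x i"
  define S where "S = piece X n x i"
  have cid: "closed_ideal UNIV B" using assms(1) by (simp add: is_multiplier_algebra_of_def)
  interpret proper_ideal B
    using cid one_notin_stable_ideal[OF cid assms(2,3)] by (rule proper_ideal.intro)
  have I0: "(\<lambda>_. 0) \<in> ideal_I B X" by (simp add: ideal_I_def C0_norm_zero)
  \<comment> \<open>The conditions on a single piece, relative to the one \<open>u\<close> that is
    shared by all pieces.\<close>
  define R where "R u i \<longleftrightarrow> (let S = piece X n x i in
    \<exists>v\<in>Cb_strict B S. \<exists>w\<in>Cb_strict B S. \<exists>ut\<in>Cb_strict B S.
      (\<forall>s\<in>S. star (v s) * v s = 1 \<and> v s * star (v s) = p i s \<and>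
        w s * star (w s) = 1 \<and> star (w s) * w s = q i s \<and> partial_isometry (ut s)) \<and>
      quot_map (Cb_strict B S) (C0_norm B S) ut =
        quot_map (Cb_strict B S) (C0_norm B S) (\<lambda>s. w s * (q i s * u s * p i s) * v s) \<and>
      T i \<in> Cb_strict B S \<and> (\<forall>s\<in>S. T i s = star (w s) * ut s * star (v s)))" for u i
  obtain u where uI: "u \<in> mult_I B X"
    and U: "coset_star (quot_map (mult_I B X) (ideal_I B X) u) \<otimes>\<^bsub>corona B X\<^esub>
        quot_map (mult_I B X) (ideal_I B X) u = P"
      "quot_map (mult_I B X) (ideal_I B X) u \<otimes>\<^bsub>corona B X\<^esub>
        coset_star (quot_map (mult_I B X) (ideal_I B X) u) = Q"
    and "\<forall>i\<le>n. R u i"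
    using assms(14) unfolding associated_isometries_def Let_def R_def by blast
  then have "R u i" using i by blast
  then obtain v w ut where M: "v \<in> Cb_strict B S" "w \<in> Cb_strict B S" "ut \<in> Cb_strict B S"
    and vw': "\<forall>s\<in>S. star (v s) * v s = 1 \<and> v s * star (v s) = p i s \<and>
        w s * star (w s) = 1 \<and> star (w s) * w s = q i s \<and> partial_isometry (ut s)"
    and ut: "quot_map (Cb_strict B S) (C0_norm B S) ut =
        quot_map (Cb_strict B S) (C0_norm B S) (\<lambda>s. w s * (q i s * u s * p i s) * v s)"
    and T': "\<forall>s\<in>S. T i s = star (w s) * ut s * star (v s)"
    unfolding R_def Let_def S_def[symmetric] by blast
  have vw: "\<And>s. s \<in> S \<Longrightarrow> star (v s) * v s = 1" "\<And>s. s \<in> S \<Longrightarrow> v s * star (v s) = p i s"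
      "\<And>s. s \<in> S \<Longrightarrow> w s * star (w s) = 1" "\<And>s. s \<in> S \<Longrightarrow> star (w s) * w s = q i s"
    and pi: "\<And>s. s \<in> S \<Longrightarrow> partial_isometry (ut s)"
    and T: "\<And>s. s \<in> S \<Longrightarrow> T i s = star (w s) * ut s * star (v s)"
    using vw' T' by blast+
  have uu: "u \<in> quot_map (mult_I B X) (ideal_I B X) u"
    "(\<lambda>s. star (u s)) \<in> coset_star (quot_map (mult_I B X) (ideal_I B X) u)"
    using mem_quot_map[OF I0] by (auto simp: coset_star_def)
  \<comment> \<open>\<open>P\<close> and \<open>Q\<close> are the sets of functions that agree with
    the tuples \<open>p\<close> and \<open>q\<close> modulo the ideal of every piece. Membership of
    the two products thus compares them with \<open>p i\<close> and \<open>q i\<close>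
    locally.\<close>
  have "(\<lambda>s. star (u s) * u s) \<in> represented_element B X n x p"
    "(\<lambda>s. u s * star (u s)) \<in> represented_element B X n x q"
    using mult_mem_corona_mult[OF I0 uu(2,1)] mult_mem_corona_mult[OF I0 uu(1,2)] U assms(9,10)
    by (auto simp: local_lifting_def)
  then have uJ: "(\<lambda>s. star (u s) * u s - p i s) \<in> C0_norm B S"
    "(\<lambda>s. u s * star (u s) - q i s) \<in> C0_norm B S"
    using i by (auto simp: represented_element_def S_def)
  have pqM: "p i \<in> Cb_strict B S" "q i \<in> Cb_strict B S"
    and proj: "\<And>s. s \<in> S \<Longrightarrow> projection (p i s)" "\<And>s. s \<in> S \<Longrightarrow> projection (q i s)"
    using assms(9,10) i by (auto simp: local_lifting_def local_tuple_def S_def)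
  have "S \<subseteq> points X" by (auto simp: S_def piece_def)
  then have uM: "u \<in> Cb_strict B S"
    using uI by (auto simp: mult_I_def Cb_strict_def strict_continuous_on_def
        intro: bounded_subset continuous_on_subset)
  have utJ: "(\<lambda>s. ut s - w s * (q i s * u s * p i s) * v s) \<in> C0_norm B S"
    using quot_map_eqD[OF C0_norm_zero ut] by simp
  \<comment> \<open>The lifting condition for the adjoint, in the form that the defect estimate
    requires once \<open>p\<close> and \<open>q\<close> are exchanged.\<close>
  have utJ': "(\<lambda>s. star (ut s) - star (v s) * (p i s * star (u s) * q i s) * star (w s)) \<in> C0_norm B S"
  proof (rule C0_norm_cong[OF _ C0_norm_star[OF utJ]])
    fix s assume "s \<in> S"
    then have "star (p i s) = p i s" "star (q i s) = q i s" using proj by (auto simp: projection_def)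
    then show "star (ut s - w s * (q i s * u s * p i s) * v s)
        = star (ut s) - star (v s) * (p i s * star (u s) * q i s) * star (w s)"
      by (simp add: star_diff star_mult mult.assoc)
  qed
  have TT: "star (T i s) * T i s = v s * (star (ut s) * ut s) * star (v s)"
    "T i s * star (T i s) = star (w s) * (ut s * star (ut s)) * w s" if "s \<in> S" for s
  proof -
    have "w s * (star (w s) * z) = z" "star (v s) * (v s * z) = z" for z
      using vw[OF that] by (simp_all add: mult.assoc[symmetric])
    then show "star (T i s) * T i s = v s * (star (ut s) * ut s) * star (v s)"
      "T i s * star (T i s) = star (w s) * (ut s * star (ut s)) * w s"
      by (simp_all add: T[OF that] star_mult star_star mult.assoc)
  qed
  have pJ: "(\<lambda>s. p i s - star (T i s) * T i s) \<in> C0_norm B S"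
  proof (rule C0_norm_cong)
    show "(\<lambda>s. p i s - v s * (star (ut s) * ut s) * star (v s)) \<in> C0_norm B S"
      using defect_C0_norm[OF uM pqM M proj vw uJ utJ] .
    fix s assume "s \<in> S"
    from TT(1)[OF this] show "p i s - v s * (star (ut s) * ut s) * star (v s) = p i s - star (T i s) * T i s"
      by simp
  qed
  \<comment> \<open>The defect of \<open>q\<close> is the defect of the adjoint data:
    \<open>u\<close> and \<open>ut\<close> become their adjoints, \<open>p\<close> and
    \<open>q\<close> trade places, and \<open>star w\<close>, \<open>star v\<close> act as
    \<open>v\<close>, \<open>w\<close>.\<close>
  have "(\<lambda>s. q i s - star (w s) * (star (star (ut s)) * star (ut s)) * star (star (w s))) \<in> C0_norm B S"
    using uJ vw
    by (intro defect_C0_norm[OF Cb_strict_star[OF uM] pqM(2,1) Cb_strict_star[OF M(2)]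
          Cb_strict_star[OF M(1)] Cb_strict_star[OF M(3)] proj(2,1) _ _ _ _ _ _ utJ'])
      (simp_all add: star_star)
  then have qJ: "(\<lambda>s. q i s - T i s * star (T i s)) \<in> C0_norm B S"
    by (rule C0_norm_cong[rotated]) (simp only: TT(2) star_star)
  have TP: "projection (star (T i s) * T i s)" "p i s * (star (T i s) * T i s) = star (T i s) * T i s"
    "q i s * (T i s * star (T i s)) = T i s * star (T i s)" if "s \<in> S" for s
  proof -
    show "projection (star (T i s) * T i s)"
      using pi[OF that] vw(1)[OF that] by (simp add: TT[OF that] partial_isometry_def projection_conj)
    have "p i s * v s = v s" "q i s * star (w s) = star (w s)"
      using vw[OF that] by (metis mult.assoc mult.right_neutral)+
    then show "p i s * (star (T i s) * T i s) = star (T i s) * T i s"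
      "q i s * (T i s * star (T i s)) = T i s * star (T i s)"
      by (simp_all add: TT[OF that] mult.assoc[symmetric])
  qed
  have dp: "projection (p i s - star (T i s) * T i s)" "projection (q i s - T i s * star (T i s))"
    if "s \<in> S" for s
    using projection_diff(1) proj[OF that] TP[OF that] projection_range by blast+
  have dB: "p i s - star (T i s) * T i s \<in> B" "q i s - T i s * star (T i s) \<in> B" if "s \<in> S" for s
    using pJ qJ that by (auto simp: C0_norm_def)
  have sS: "s \<in> S" using s by (simp add: S_def)
  have S: "connected S" by (simp add: S_def connected_piece)
  \<comment> \<open>The defects are norm continuous and the piece is connected, so both classes may
    be evaluated at the given point \<open>s\<close>, where the essential codimensions are
    taken.\<close>
  have "K0_class_on B S (\<lambda>s. p i s - star (T i s) * T i s) = K0_class B (p i s - star (T i s) * T i s)"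
    "K0_class_on B S (\<lambda>s. q i s - T i s * star (T i s)) = K0_class B (q i s - T i s * star (T i s))"
    using K0_class_on_eq[OF S sS _ dB(1) dp(1)] K0_class_on_eq[OF S sS _ dB(2) dp(2)] pJ qJ
    by (simp_all add: C0_norm_def)
  then show "defect_class B (piece X n x i) (p i) (q i) (T i) =
      K0_diff B (ess_codim B \<Phi> (p i s) (star (T i s) * T i s))
                (ess_codim B \<Phi> (q i s) (T i s * star (T i s)))"
    using K0_diff_ess_codim[OF assms(5) proj[OF sS] TP[OF sS] dB[OF sS]]
    by (simp add: defect_class_def S_def)
qed

end
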